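(* Let $X$ be a complex Hilbert space and let $A$ be the generator of a bounded $C_0$-semigroup $(T(t))_{t\ge0}$ on $X$. Suppose that $\sigma(A)\cap i\mathbb{R}=\{0\}$ and that $M_0,M_\infty\colon[1,\infty)\to(0,\infty)$ are continuous non-decreasing functions such that $\|R(is^{-1},A)\|\le M_0(|s|)$ and $\|R(is,A)\|\le M_\infty(|s|)$ for all $s\in\mathbb{R}$ with $|s|\ge1$. Let $M\colon[1,\infty)\to(0,\infty)$ be defined by $M(s)=\max\{M_0(s),M_\infty(s)\}$, $s\ge1$, and suppose that $M$ has positive increase. Then $$\|T(t)AR(1,A)^2\|=O\left(\frac{1}{M^{-1}(t)}\right),\quad t\to\infty.$$
   Context: A $C_0$-semigroup is bounded if $\sup_{t\ge0}\|T(t)\|<\infty$. For a closed operator $A$, $\sigma(A)$ is its spectrum and $R(z,A)=(zI-A)^{-1}$ for $z\notin\sigma(A)$. Given $a\ge0$, a measurable function $M\colon[a,\infty)\to(0,\infty)$ has positive increase if there exist constants $\alpha>0$, $c\in(0,1]$ and $s_0\ge a$ with $s_0>0$ such that $M(\lambda s)/M(s)\ge c\lambda^\alpha$ for all $\lambda\ge1$ and $s\ge s_0$ (in particular $M(s)\to\infty$ as $s\to\infty$). For a continuous non-decreasing function $M\colon[a,\infty)\to(0,\infty)$ with $M(s)\to\infty$ as $s\to\infty$, $M^{-1}$ denotes its right-continuous right-inverse $M^{-1}(t)=\sup\{r\ge a: M(r)\le t\}$, $t\ge M(a)$. $f(t)=O(g(t))$, $t\to\infty$, means there is a constant $C>0$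 with $f(t)\le Cg(t)$ for all sufficiently large $t$. *)

theory Defs
  imports "HOL-Analysis.Analysis" "HOL-Library.Landau_Symbols"
begin

class scaleC =
  fixes scaleC :: "complex \<Rightarrow> 'a \<Rightarrow> 'a" (infixr "*\<^sub>C" 75)

class complex_vector = real_vector + scaleC +
  assumes scaleC_add_right: "c *\<^sub>C (x + y) = c *\<^sub>C x + c *\<^sub>C y"
    and scaleC_add_left: "(c + d) *\<^sub>C x = c *\<^sub>C x + d *\<^sub>C x"
    and scaleC_scaleC: "c *\<^sub>C (d *\<^sub>C x) = (c * d) *\<^sub>C x"
    and scaleC_one: "1 *\<^sub>C x = x"
    and scaleR_scaleC: "r *\<^sub>R x = complex_of_real r *\<^sub>C x"

text \<open>The inner product is linear in its first argument. Positive definiteness is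
  contained in the last axiom together with the norm axioms of
  \<^class>\<open>real_normed_vector\<close>, since the norm is nonnegative and vanishes only at 0.\<close>

class complex_inner = complex_vector + real_normed_vector +
  fixes cinner :: "'a \<Rightarrow> 'a \<Rightarrow> complex"
  assumes cinner_commute: "cinner x y = cnj (cinner y x)"
    and cinner_add_left: "cinner (x + y) z = cinner x z + cinner y z"
    and cinner_scaleC_left: "cinner (c *\<^sub>C x) y = c * cinner x y"
    and cinner_self: "cinner x x = complex_of_real ((norm x)\<^sup>2)"

class complex_hilbert_space = complex_inner + banach

text \<open>The scalar field is an instance, so the class is inhabited.\<close>

instantiation complex :: complex_hilbert_space
begin

definition scaleC_complex :: "complex \<Rightarrow> complex \<Rightarrow> complex"
  where "scaleC_complex c x = c * x"

definition cinner_complex :: "complex \<Rightarrow> complex \<Rightarrow> complex"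
  where "cinner_complex x y = x * cnj y"

instance
  by standard
    (auto simp: scaleC_complex_def cinner_complex_def algebra_simps scaleR_conv_of_real
      simp flip: complex_norm_square)

end

definition bounded_clinear :: "('a::complex_inner \<Rightarrow> 'b::complex_inner) \<Rightarrow> bool"
  where "bounded_clinear f \<longleftrightarrow> bounded_linear f \<and> (\<forall>c x. f (c *\<^sub>C x) = c *\<^sub>C f x)"

text \<open>Semigroups are functions on all of \<^typ>\<open>real\<close>; values at negative times are irrelevant.\<close>

definition C0_semigroup :: "(real \<Rightarrow> 'a::complex_hilbert_space \<Rightarrow> 'a) \<Rightarrow> bool"
  where "C0_semigroup T \<longleftrightarrow>
    (\<forall>t\<ge>0. bounded_clinear (T t)) \<and>
    T 0 = id \<and>
    (\<forall>s\<ge>0. \<forall>t\<ge>0. T (s + t) = T s \<circ> T t) \<and>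
    (\<forall>x. ((\<lambda>t. T t x) \<longlongrightarrow> x) (at_right 0))"

definition bounded_semigroup :: "(real \<Rightarrow> 'a::complex_hilbert_space \<Rightarrow> 'a) \<Rightarrow> bool"
  where "bounded_semigroup T \<longleftrightarrow> bdd_above ((\<lambda>t. onorm (T t)) ` {0..})"

text \<open>An unbounded operator is given by its domain \<open>D\<close> and a total function \<open>A\<close> whose
  values outside \<open>D\<close> are irrelevant.\<close>

definition is_generator ::
    "(real \<Rightarrow> 'a::complex_hilbert_space \<Rightarrow> 'a) \<Rightarrow> 'a set \<Rightarrow> ('a \<Rightarrow> 'a) \<Rightarrow> bool"
  where "is_generator T D A \<longleftrightarrow>
    D = {x. \<exists>y. ((\<lambda>h. (T h x - x) /\<^sub>R h) \<longlongrightarrow> y) (at_right 0)} \<and>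
    (\<forall>x\<in>D. ((\<lambda>h. (T h x - x) /\<^sub>R h) \<longlongrightarrow> A x) (at_right 0))"

definition resolvent ::
    "'a::complex_hilbert_space set \<Rightarrow> ('a \<Rightarrow> 'a) \<Rightarrow> complex \<Rightarrow> 'a \<Rightarrow> 'a"
  where "resolvent D A z = inv_into D (\<lambda>x. z *\<^sub>C x - A x)"

definition spectrum :: "'a::complex_hilbert_space set \<Rightarrow> ('a \<Rightarrow> 'a) \<Rightarrow> complex set"
  where "spectrum D A =
    {z. \<not> (bij_betw (\<lambda>x. z *\<^sub>C x - A x) D UNIV \<and> bounded_clinear (resolvent D A z))}"

definition positive_increase :: "real \<Rightarrow> (real \<Rightarrow> real) \<Rightarrow> bool"
  where "positive_increase a M \<longleftrightarrow>
    0 \<le> a \<and> M \<in> borel_measurable (lebesgue_on {a..}) \<and> (\<forall>s\<ge>a. 0 < M s) \<and>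
    (\<exists>\<alpha>>0. \<exists>c\<in>{0<..1}. \<exists>s0\<ge>a. 0 < s0 \<and>
      (\<forall>l\<ge>1. \<forall>s\<ge>s0. M (l * s) / M s \<ge> c * l powr \<alpha>))"

text \<open>Meaningful for \<open>t \<ge> M a\<close> when \<open>M\<close> tends to infinity: then the set is nonempty
  and bounded above.\<close>

definition right_inverse :: "real \<Rightarrow> (real \<Rightarrow> real) \<Rightarrow> real \<Rightarrow> real"
  where "right_inverse a M t = Sup {r. a \<le> r \<and> M r \<le> t}"

end

theory Submission
  imports Defs "HOL-Computational_Algebra.Polynomial"
begin

text \<open>Put \<open>y = A R(1,A)\<^sup>2 x\<close>, fix \<open>m\<close> with \<open>\<alpha> m \<ge> 1\<close> and \<open>r\<close> with \<open>M(r) \<le> t\<close>, and let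
  \<open>\<phi>(s) = s\<^sup>m (1 - s)\<^sup>m\<close>. The \<open>k\<close>-th Fourier coefficient on \<open>[0,1]\<close> of
  \<open>g(s) = e\<^sup>-\<^sup>s \<phi>(s) T(t s) y\<close> equals, after \<open>m\<close> integrations by parts, \<open>t\<^sup>-\<^sup>m R(z,A)\<^sup>m\<close> applied to
  that of \<open>e\<^sup>-\<^sup>s \<phi>\<^sup>(\<^sup>m\<^sup>)(s) T(t s) y\<close>, where \<open>z = (1 + 2\<pi>ik) / t\<close>. Up to lower powers of the resolvent,
  \<open>R(z,A)\<^sup>m y\<close> is \<open>z (1 - z)\<^sup>-\<^sup>2 R(z,A)\<^sup>m x\<close>, and this operator has norm \<open>O(t\<^sup>m / r)\<close>: at frequencies
  outside \<open>[1/r, r]\<close> because of the scalar factor, at the others by positive increase. The lower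
  powers are harmless since \<open>M(s) \<ge> s\<close>, as \<open>0\<close> belongs to the spectrum, so that \<open>r \<le> t\<close>.
  Bessel's inequality for \<open>x\<close> and Parseval's identity for \<open>g\<close> then give
  \<open>\<integral>\<parallel>g\<parallel>\<^sup>2 = O(r\<^sup>-\<^sup>2 \<parallel>x\<parallel>\<^sup>2)\<close>, and boundedness of the semigroup bounds \<open>\<parallel>T(t) y\<parallel>\<close> by this mean.\<close>

section \<open>Fourier coefficients of Hilbert space valued functions\<close>

text \<open>The Hilbert space enters through Bessel and Parseval, which turn a bound at each
  frequency into a bound in mean. The obstacle is that one resolvent does not suffice: at frequency
  \<open>s\<close> or \<open>1 / s\<close> the scalar factor and one resolvent give
  \<open>M s / s\<close>, and positive increase with small \<alpha> does not compare this with
  \<open>M r / r\<close>. For \<open>M s ^ m / s\<close> it does, once \<alpha> m is at least 1.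
  Each integration by parts supplies one resolvent and one factor \<open>1 / t\<close>. The zeros of
  order m of the weight at both ends remove the boundary terms and close \<open>g\<close> up to a
  Lipschitz function on the circle, to which Fejer means apply. The factor exp(-s) moves the
  frequencies from the imaginary axis to the line Re z = 1/t, where R(z,A) exists and has norm at
  most K t (K a bound of the semigroup) for every k, including k = 0, where the axis meets the
  spectrum. Finally, \<open>r\<close> is any large point with \<open>M r \<le> t\<close>: a constant
  independent of \<open>r\<close> lets the estimate pass to the supremum that defines
  \<open>right_inverse\<close>.\<close>

lemma norm_scaleC: "norm (c *\<^sub>C x) = cmod c * norm (x :: 'a::complex_inner)"
proof -
  have "complex_of_real ((norm (c *\<^sub>C x))\<^sup>2) = c * cnj c * complex_of_real ((norm x)\<^sup>2)"
    by (metis (no_types, lifting) cinner_self cinner_scaleC_left cinner_commute complex_cnj_mult mult.assoc)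
  also have "\<dots> = complex_of_real ((cmod c * norm x)\<^sup>2)"
    by (simp only: complex_norm_square power_mult_distrib of_real_mult)
  finally have "(norm (c *\<^sub>C x))\<^sup>2 = (cmod c * norm x)\<^sup>2"
    by (simp only: of_real_eq_iff)
  then show ?thesis
    by (simp add: power2_eq_iff_nonneg)
qed

interpretation scaleC: bounded_bilinear "\<lambda>c (x::'a::complex_inner). c *\<^sub>C x"
proof
  fix a a' :: complex and b b' :: 'a and r :: real
  show "(a + a') *\<^sub>C b = a *\<^sub>C b + a' *\<^sub>C b" by (rule scaleC_add_left)
  show "a *\<^sub>C (b + b') = a *\<^sub>C b + a *\<^sub>C b'" by (rule scaleC_add_right)
  show "(r *\<^sub>R a) *\<^sub>C b = r *\<^sub>R (a *\<^sub>C b)"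
    by (simp only: scaleR_scaleC[where 'a='a] scaleC_scaleC scaleR_conv_of_real[where 'a=complex])
  show "a *\<^sub>C r *\<^sub>R b = r *\<^sub>R (a *\<^sub>C b)"
    by (simp add: scaleR_scaleC scaleC_scaleC mult.commute)
  show "\<exists>K. \<forall>(a::complex) (b::'a). norm (a *\<^sub>C b) \<le> norm a * norm b * K"
    by (rule exI[of _ 1]) (simp add: norm_scaleC)
qed

text \<open>The inner product is only conjugate-linear in its second argument. Its real part is real
  bilinear, so \<open>bounded_bilinear\<close> applies, and it still determines the norm.\<close>

definition rinner :: "'a::complex_inner \<Rightarrow> 'a \<Rightarrow> real"
  where "rinner x y = Re (cinner x y)"

lemma rinner_commute: "rinner x y = rinner y x"
  unfolding rinner_def by (metis cinner_commute complex_cnj cnj.sel(1))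

lemma rinner_add_left: "rinner (x + y) z = rinner x z + rinner y z"
  by (simp add: rinner_def cinner_add_left)

lemma rinner_self: "rinner x x = (norm x)\<^sup>2"
  by (simp add: rinner_def cinner_self)

lemma rinner_scaleC_left: "rinner (c *\<^sub>C x) y = rinner x (cnj c *\<^sub>C y)"
  unfolding rinner_def
  by (metis cinner_commute cinner_scaleC_left complex_cnj_cnj complex_cnj_mult)

lemma rinner_scaleR_left: "rinner (r *\<^sub>R x) y = r * rinner x y"
  by (simp add: rinner_def scaleR_scaleC cinner_scaleC_left)

lemma norm_add_squared: "(norm (x + y))\<^sup>2 = (norm x)\<^sup>2 + 2 * rinner x y + (norm y)\<^sup>2"
  by (metis (no_types, lifting) add.assoc mult_2 rinner_add_left rinner_commute rinner_self)

text \<open>Cauchy-Schwarz is read off from the triangle inequality, which the class already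
  provides: square it and cancel.\<close>

lemma rinner_le: "rinner x y \<le> norm x * norm y"
proof -
  have "(norm (x + y))\<^sup>2 \<le> (norm x + norm y)\<^sup>2"
    by (rule power_mono) (simp_all add: norm_triangle_ineq)
  then show ?thesis by (simp add: norm_add_squared power2_sum)
qed

interpretation rinner: bounded_bilinear "rinner :: 'a::complex_inner \<Rightarrow> 'a \<Rightarrow> real"
proof
  fix a a' b b' :: 'a and r :: real
  show "rinner (a + a') b = rinner a b + rinner a' b" by (rule rinner_add_left)
  show "rinner a (b + b') = rinner a b + rinner a b'"
    by (metis rinner_add_left rinner_commute)
  show "rinner (r *\<^sub>R a) b = r *\<^sub>R rinner a b" by (simp add: rinner_scaleR_left)
  show "rinner a (r *\<^sub>R b) = r *\<^sub>R rinner a b"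
    by (metis rinner_scaleR_left rinner_commute real_scaleR_def)
  have "\<bar>rinner x y\<bar> \<le> norm x * norm y" for x y :: 'a
    using rinner_le[of x y] rinner_le[of "(-1) *\<^sub>R x" y, unfolded rinner_scaleR_left norm_scaleR]
    by (simp add: abs_le_iff)
  then show "\<exists>K. \<forall>(a::'a) b. norm (rinner a b) \<le> norm a * norm b * K"
    by (intro exI[of _ 1]) simp
qed

section \<open>Characters of the circle and Bessel's inequality\<close>

definition unit_exp :: "int \<Rightarrow> real \<Rightarrow> complex"
  where "unit_exp k s = cis (2 * pi * (real_of_int k * s))"

lemma unit_exp_add: "unit_exp (j + k) s = unit_exp j s * unit_exp k s"
  by (simp add: unit_exp_def cis_mult algebra_simps)

lemma unit_exp_plus: "unit_exp k (r + s) = unit_exp k r * unit_exp k s"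
  by (simp add: unit_exp_def cis_mult algebra_simps)

lemma cnj_unit_exp: "cnj (unit_exp k s) = unit_exp (- k) s"
  by (simp add: unit_exp_def cis_cnj)

lemma unit_exp_uminus: "unit_exp (- k) s = unit_exp k (- s)"
  by (simp add: unit_exp_def)

lemma unit_exp_0 [simp]: "unit_exp 0 s = 1" "unit_exp k 0 = 1"
  by (simp_all add: unit_exp_def)

lemma unit_exp_1 [simp]: "unit_exp k 1 = 1"
  by (simp add: unit_exp_def cis_multiple_2pi)

lemma norm_unit_exp [simp]: "cmod (unit_exp k s) = 1"
  by (simp add: unit_exp_def)

lemma continuous_on_unit_exp [continuous_intros]:
  "continuous_on S f \<Longrightarrow> continuous_on S (\<lambda>s. unit_exp k (f s))"
  unfolding unit_exp_def by (intro continuous_intros)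

lemma integral_unit_exp: "integral {0..1} (unit_exp k) = (if k = 0 then 1 else 0)"
proof (cases "k = 0")
  case True
  then have "unit_exp k = (\<lambda>_. 1)" by (simp add: fun_eq_iff)
  then show ?thesis using True by simp
next
  case False
  define c where "c = \<i> * complex_of_real (2 * pi * real_of_int k)"
  have "c \<noteq> 0" using False by (simp add: c_def)
  have e: "unit_exp k s = exp (c * complex_of_real s)" for s
    by (simp add: unit_exp_def cis_conv_exp c_def algebra_simps)
  have "((\<lambda>s. exp (c * complex_of_real s) / c) has_vector_derivative unit_exp k s) (at s within {0..1})" for s
    using \<open>c \<noteq> 0\<close> unfolding e
    by (auto intro!: derivative_eq_intros has_vector_derivative_real_field)
  then have "(unit_exp k has_integral (exp (c * complex_of_real 1) / c - exp (c * complex_of_real 0) / c)) {0..1}"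
    by (intro fundamental_theorem_of_calculus) auto
  moreover have "exp c = 1" using e[of 1] by simp
  ultimately show ?thesis using False by (simp add: integral_unique)
qed

lemma continuous_on_scaleC [continuous_intros]:
  fixes g :: "'b::topological_space \<Rightarrow> 'a::complex_inner"
  shows "continuous_on S f \<Longrightarrow> continuous_on S g \<Longrightarrow> continuous_on S (\<lambda>s. f s *\<^sub>C g s)"
  by (rule scaleC.continuous_on)

lemma continuous_on_rinner [continuous_intros]:
  fixes g :: "'b::topological_space \<Rightarrow> 'a::complex_inner"
  shows "continuous_on S f \<Longrightarrow> continuous_on S g \<Longrightarrow> continuous_on S (\<lambda>s. rinner (f s) (g s))"
  by (rule rinner.continuous_on)

definition fourier_coeff :: "(real \<Rightarrow> 'a::complex_hilbert_space) \<Rightarrow> int \<Rightarrow> 'a"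
  where "fourier_coeff f k = integral {0..1} (\<lambda>s. unit_exp (- k) s *\<^sub>C f s)"

lemma integral_rinner_unit_exp:
  fixes f :: "real \<Rightarrow> 'a::complex_hilbert_space"
  assumes "continuous_on {0..1} f"
  shows "integral {0..1} (\<lambda>s. rinner (f s) (unit_exp k s *\<^sub>C v)) = rinner (fourier_coeff f k) v"
proof -
  have "(\<lambda>s. unit_exp (- k) s *\<^sub>C f s) integrable_on {0..1}"
    by (intro integrable_continuous_real continuous_intros assms)
  from integral_linear[OF this rinner.bounded_linear_left[of v]]
  show ?thesis
    by (simp add: fourier_coeff_def o_def rinner_scaleC_left cnj_unit_exp)
qed

lemma integral_rinner_unit_exps:
  fixes v w :: "'a::complex_hilbert_space"
  shows "integral {0..1} (\<lambda>s. rinner (unit_exp j s *\<^sub>C v) (unit_exp k s *\<^sub>C w)) =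
    (if j = k then rinner v w else 0)"
proof -
  have "unit_exp (j - k) integrable_on {0..1}"
    unfolding unit_exp_def by (intro integrable_continuous_real continuous_intros)
  from integral_linear[OF this bounded_linear_compose[OF rinner.bounded_linear_left[of w] scaleC.bounded_linear_left[of v]]]
  have "integral {0..1} (\<lambda>s. rinner (unit_exp (j - k) s *\<^sub>C v) w) =
      rinner ((if j = k then 1 else 0) *\<^sub>C v) w"
    by (simp add: o_def integral_unit_exp)
  moreover have "rinner (unit_exp (j - k) s *\<^sub>C v) w = rinner (unit_exp j s *\<^sub>C v) (unit_exp k s *\<^sub>C w)" for s
  proof -
    have "unit_exp (j - k) s *\<^sub>C v = unit_exp (-k) s *\<^sub>C (unit_exp j s *\<^sub>C v)"
      using unit_exp_add[of "-k" j s] by (simp add: scaleC_scaleC)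
    then show ?thesis by (simp add: rinner_scaleC_left cnj_unit_exp)
  qed
  ultimately show ?thesis by (simp add: scaleC_one scaleC.zero_left rinner.zero_left)
qed

text \<open>Integrate the square of \<open>norm (f s - p s)\<close>, with \<open>p\<close> the
  partial Fourier sum over \<open>F\<close>: the pairing of \<open>f\<close> with \<open>p\<close>
  and the square of \<open>p\<close> both integrate to the sum on the left.\<close>

lemma bessel_inequality:
  fixes f :: "real \<Rightarrow> 'a::complex_hilbert_space"
  assumes f: "continuous_on {0..1} f" and "finite F"
  shows "(\<Sum>k\<in>F. (norm (fourier_coeff f k))\<^sup>2) \<le> integral {0..1} (\<lambda>s. (norm (f s))\<^sup>2)"
proof -
  define v where "v = fourier_coeff f"
  define p where "p s = (\<Sum>k\<in>F. unit_exp k s *\<^sub>C v k)" for s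
  have p: "continuous_on {0..1} p"
    unfolding p_def by (intro continuous_intros)
  note ints = integrable_continuous_real continuous_intros f p
  have fp: "integral {0..1} (\<lambda>s. rinner (f s) (p s)) = (\<Sum>k\<in>F. (norm (v k))\<^sup>2)"
  proof -
    have "integral {0..1} (\<lambda>s. rinner (f s) (p s)) =
        (\<Sum>k\<in>F. integral {0..1} (\<lambda>s. rinner (f s) (unit_exp k s *\<^sub>C v k)))"
      unfolding p_def rinner.sum_right
      by (intro integral_sum \<open>finite F\<close> ints)
    then show ?thesis by (simp add: integral_rinner_unit_exp[OF f] v_def rinner_self)
  qed
  have pp: "integral {0..1} (\<lambda>s. rinner (p s) (p s)) = (\<Sum>k\<in>F. (norm (v k))\<^sup>2)"
  proof -
    have "integral {0..1} (\<lambda>s. rinner (p s) (p s)) =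
        (\<Sum>k\<in>F. \<Sum>j\<in>F. integral {0..1} (\<lambda>s. rinner (unit_exp j s *\<^sub>C v j) (unit_exp k s *\<^sub>C v k)))"
      unfolding p_def rinner.sum_right rinner.sum_left
      by (subst integral_sum, simp add: \<open>finite F\<close>, intro ints, intro sum.cong refl integral_sum \<open>finite F\<close> ints)
    also have "\<dots> = (\<Sum>k\<in>F. \<Sum>j\<in>F. if j = k then (norm (v k))\<^sup>2 else 0)"
      by (simp add: integral_rinner_unit_exps rinner_self if_distrib cong: if_cong sum.cong)
    finally show ?thesis using \<open>finite F\<close> by simp
  qed
  have "0 \<le> integral {0..1} (\<lambda>s. (norm (f s - p s))\<^sup>2)"
    by (intro integral_nonneg ints) simp
  also have "(\<lambda>s. (norm (f s - p s))\<^sup>2) = (\<lambda>s. (norm (f s))\<^sup>2 - 2 * rinner (f s) (p s) + rinner (p s) (p s))"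
    using norm_add_squared[of "f _" "- p _"] by (simp add: rinner.minus_right rinner_self)
  also have "integral {0..1} \<dots> = integral {0..1} (\<lambda>s. (norm (f s))\<^sup>2)
      - 2 * integral {0..1} (\<lambda>s. rinner (f s) (p s)) + integral {0..1} (\<lambda>s. rinner (p s) (p s))"
    by (subst integral_add integral_diff integral_mult_right; (intro ints)?)+ simp
  finally show ?thesis by (simp add: fp pp v_def)
qed

section \<open>Fejer means and Parseval's identity for Lipschitz functions\<close>

definition dirichlet_sum :: "nat \<Rightarrow> real \<Rightarrow> complex"
  where "dirichlet_sum N u = (\<Sum>j<N. unit_exp (int j) u)"

text \<open>Usually written as the sum of (1 - |k|/N) times the k-th character over |k| < N. The
  squared modulus makes nonnegativity evident, and expanding it produces the differences
  \<open>int j - int l\<close>.\<close>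

definition fejer_kernel :: "nat \<Rightarrow> real \<Rightarrow> real"
  where "fejer_kernel N u = (cmod (dirichlet_sum N u))\<^sup>2 / real N"

lemma of_real_fejer_kernel:
  "complex_of_real (fejer_kernel N u) = (\<Sum>j<N. \<Sum>l<N. unit_exp (int j - int l) u) / of_nat N"
proof -
  have "complex_of_real ((cmod (dirichlet_sum N u))\<^sup>2) = dirichlet_sum N u * cnj (dirichlet_sum N u)"
    by (rule complex_norm_square)
  also have "\<dots> = (\<Sum>j<N. \<Sum>l<N. unit_exp (int j) u * unit_exp (- int l) u)"
    by (simp add: dirichlet_sum_def cnj_unit_exp sum_product)
  also have "\<dots> = (\<Sum>j<N. \<Sum>l<N. unit_exp (int j - int l) u)"
    by (simp flip: unit_exp_add)
  finally show ?thesis by (simp add: fejer_kernel_def)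
qed

lemma fejer_kernel_nonneg: "0 \<le> fejer_kernel N u"
  by (simp add: fejer_kernel_def)

lemma continuous_on_fejer_kernel [continuous_intros]:
  "continuous_on S f \<Longrightarrow> continuous_on S (\<lambda>s. fejer_kernel N (f s))"
  unfolding fejer_kernel_def dirichlet_sum_def divide_inverse by (intro continuous_intros)

text \<open>Telescoping the geometric sum bounds chord times Dirichlet sum by 2, so the kernel times
  the squared chord is at most 4/N. The arithmetic-geometric mean inequality with weight \<epsilon>
  trades the first power of the chord for the second.\<close>

lemma fejer_kernel_times_chord:
  assumes "N > 0" "\<epsilon> > 0"
  shows "fejer_kernel N u * cmod (unit_exp 1 u - 1) \<le> \<epsilon> / 2 * fejer_kernel N u + 2 / (real N * \<epsilon>)"
proof -
  define d where "d = cmod (unit_exp 1 u - 1)"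
  have pow: "unit_exp (int j) u = unit_exp 1 u ^ j" for j
    by (induction j) (simp_all add: unit_exp_add)
  have "(unit_exp 1 u - 1) * dirichlet_sum N u = unit_exp (int N) u - 1"
    using power_diff_1_eq[of "unit_exp 1 u" N] by (simp add: dirichlet_sum_def pow)
  then have "d * cmod (dirichlet_sum N u) = cmod (unit_exp (int N) u - 1)"
    by (metis d_def norm_mult)
  also have "\<dots> \<le> 2"
    using norm_triangle_ineq4[of "unit_exp (int N) u" 1] by simp
  finally have "(d * cmod (dirichlet_sum N u))\<^sup>2 \<le> 2\<^sup>2"
    by (intro power_mono) (simp_all add: d_def)
  then have Kd: "fejer_kernel N u * d\<^sup>2 \<le> 4 / real N"
    using assms by (simp add: fejer_kernel_def power_mult_distrib divide_simps mult.commute)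
  have "0 \<le> (\<epsilon> - d)\<^sup>2" by simp
  then have "d \<le> \<epsilon> / 2 + d\<^sup>2 / (2 * \<epsilon>)"
    using assms by (simp add: power2_eq_square field_simps)
  then have "fejer_kernel N u * d \<le> fejer_kernel N u * (\<epsilon> / 2 + d\<^sup>2 / (2 * \<epsilon>))"
    by (intro mult_left_mono fejer_kernel_nonneg)
  also have "\<dots> = \<epsilon> / 2 * fejer_kernel N u + fejer_kernel N u * d\<^sup>2 / (2 * \<epsilon>)"
    by (simp add: algebra_simps)
  also have "\<dots> \<le> \<epsilon> / 2 * fejer_kernel N u + 4 / real N / (2 * \<epsilon>)"
    by (intro add_left_mono divide_right_mono Kd) (use assms in simp)
  finally show ?thesis by (simp add: d_def mult.commute)
qed

text \<open>The average of the first \<open>N\<close> symmetric partial Fourier sums: k occurs N -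
  |k| times as a difference j - l. Keeping the pairs makes each row j a sum over distinct
  frequencies.\<close>

definition fejer_mean :: "nat \<Rightarrow> (real \<Rightarrow> 'a::complex_hilbert_space) \<Rightarrow> real \<Rightarrow> 'a"
  where "fejer_mean N g r =
    (\<Sum>j<N. \<Sum>l<N. unit_exp (int j - int l) r *\<^sub>C fourier_coeff g (int j - int l)) /\<^sub>R real N"

lemma continuous_on_fejer_mean [continuous_intros]:
  "continuous_on S f \<Longrightarrow> continuous_on S (\<lambda>s. fejer_mean N g (f s))"
  unfolding fejer_mean_def by (intro continuous_intros)

lemma fejer_mean_eq_integral:
  assumes g: "continuous_on {0..1} g"
  shows "fejer_mean N g r = integral {0..1} (\<lambda>s. fejer_kernel N (r - s) *\<^sub>R g s)"
proof -
  have coeff: "unit_exp k r *\<^sub>C fourier_coeff g k = integral {0..1} (\<lambda>s. unit_exp k (r - s) *\<^sub>C g s)" for k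
  proof -
    have "(\<lambda>s. unit_exp (- k) s *\<^sub>C g s) integrable_on {0..1}"
      by (intro integrable_continuous_real continuous_intros g)
    from integral_linear[OF this scaleC.bounded_linear_right[of "unit_exp k r"]]
    have "integral {0..1} (\<lambda>s. unit_exp k r *\<^sub>C unit_exp (- k) s *\<^sub>C g s) = unit_exp k r *\<^sub>C fourier_coeff g k"
      by (simp add: o_def fourier_coeff_def)
    moreover have "unit_exp k r * unit_exp (- k) s = unit_exp k (r - s)" for s
      using unit_exp_plus[of k r "-s"] by (simp add: unit_exp_uminus)
    ultimately show ?thesis by (simp add: scaleC_scaleC)
  qed
  have "fejer_kernel N (r - s) *\<^sub>R g s =
      (\<Sum>j<N. \<Sum>l<N. unit_exp (int j - int l) (r - s) *\<^sub>C g s) /\<^sub>R real N" for s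
  proof -
    have "fejer_kernel N (r - s) *\<^sub>R g s =
        (inverse (of_real (real N)) * (\<Sum>j<N. \<Sum>l<N. unit_exp (int j - int l) (r - s))) *\<^sub>C g s"
      by (simp add: scaleR_scaleC of_real_fejer_kernel field_simps)
    also have "\<dots> = (\<Sum>j<N. \<Sum>l<N. unit_exp (int j - int l) (r - s) *\<^sub>C g s) /\<^sub>R real N"
      by (simp add: scaleR_scaleC scaleC.sum_left flip: scaleC_scaleC)
    finally show ?thesis .
  qed
  then have "integral {0..1} (\<lambda>s. fejer_kernel N (r - s) *\<^sub>R g s) =
      integral {0..1} (\<lambda>s. (\<Sum>j<N. \<Sum>l<N. unit_exp (int j - int l) (r - s) *\<^sub>C g s)) /\<^sub>R real N"
    by simp
  also have "integral {0..1} (\<lambda>s. (\<Sum>j<N. \<Sum>l<N. unit_exp (int j - int l) (r - s) *\<^sub>C g s)) =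
      (\<Sum>j<N. \<Sum>l<N. integral {0..1} (\<lambda>s. unit_exp (int j - int l) (r - s) *\<^sub>C g s))"
    by (subst integral_sum, simp, intro integrable_continuous_real continuous_intros g,
      intro sum.cong refl integral_sum finite_lessThan integrable_continuous_real continuous_intros g)
  finally show ?thesis
    by (simp add: fejer_mean_def coeff)
qed

text \<open>This is the Fejer mean of the constant function 1: only its coefficient at 0 survives,
  and it is met by the \<open>N\<close> pairs with j = l.\<close>

lemma integral_fejer_kernel:
  assumes "N > 0"
  shows "integral {0..1} (\<lambda>s. fejer_kernel N (r - s)) = 1"
proof -
  have coeff: "fourier_coeff (\<lambda>s. 1 :: complex) k = (if k = 0 then 1 else 0)" for k
    using integral_unit_exp[of "-k"] by (simp add: fourier_coeff_def scaleC_complex_def)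
  have "complex_of_real (integral {0..1} (\<lambda>s. fejer_kernel N (r - s))) =
      integral {0..1} (\<lambda>s. complex_of_real (fejer_kernel N (r - s)))"
    using integral_linear[OF _ bounded_linear_of_real, of "\<lambda>s. fejer_kernel N (r - s)" "{0..1}", where ?'a1=complex]
    by (simp add: o_def integrable_continuous_real continuous_intros)
  also have "\<dots> = fejer_mean N (\<lambda>s. 1 :: complex) r"
    by (simp add: fejer_mean_eq_integral scaleR_conv_of_real)
  also have "\<dots> = (\<Sum>j<N. \<Sum>l<N. if j = l then 1 else 0) /\<^sub>R real N"
    by (simp add: fejer_mean_def coeff scaleC_complex_def if_distrib cong: if_cong sum.cong)
  also have "\<dots> = 1"
    using assms by (simp add: scaleR_conv_of_real)
  finally show ?thesis by (simp only: of_real_eq_1_iff)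
qed

text \<open>The kernel has total mass 1, so the left side is the norm of an average of
  \<open>g s - g r\<close>, and \<open>fejer_kernel_times_chord\<close> can be integrated.\<close>

lemma norm_fejer_mean_diff:
  fixes g :: "real \<Rightarrow> 'a::complex_hilbert_space"
  assumes g: "continuous_on {0..1} g"
    and lip: "\<And>s. s \<in> {0..1} \<Longrightarrow> norm (g s - g r) \<le> L * cmod (unit_exp 1 (r - s) - 1)"
    and "L \<ge> 0" "N > 0" "\<epsilon> > 0"
  shows "norm (fejer_mean N g r - g r) \<le> L * (\<epsilon> / 2 + 2 / (real N * \<epsilon>))"
proof -
  note ints = integrable_continuous_real continuous_intros g
  have K1: "((\<lambda>s. fejer_kernel N (r - s)) has_integral 1) {0..1}"
  proof -
    have "(\<lambda>s. fejer_kernel N (r - s)) integrable_on {0..1}" by (intro ints)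
    then show ?thesis by (simp add: has_integral_iff integral_fejer_kernel[OF \<open>N > 0\<close>])
  qed
  then have "integral {0..1} (\<lambda>s. fejer_kernel N (r - s) *\<^sub>R g r) = g r"
    using has_integral_scaleR_left[OF K1, of "g r"] by (simp add: integral_unique)
  then have "fejer_mean N g r - g r =
      integral {0..1} (\<lambda>s. fejer_kernel N (r - s) *\<^sub>R g s) -
      integral {0..1} (\<lambda>s. fejer_kernel N (r - s) *\<^sub>R g r)"
    by (simp add: fejer_mean_eq_integral[OF g])
  also have "\<dots> = integral {0..1} (\<lambda>s. fejer_kernel N (r - s) *\<^sub>R (g s - g r))"
    by (subst integral_diff[symmetric]; (intro ints)?) (simp add: scaleR_diff_right)
  also have "norm \<dots> \<le> integral {0..1} (\<lambda>s. L * (\<epsilon> / 2 * fejer_kernel N (r - s) + 2 / (real N * \<epsilon>)))"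
  proof (rule integral_norm_bound_integral)
    fix s :: real assume s: "s \<in> {0..1}"
    have "norm (fejer_kernel N (r - s) *\<^sub>R (g s - g r)) \<le>
        fejer_kernel N (r - s) * (L * cmod (unit_exp 1 (r - s) - 1))"
      by (simp add: fejer_kernel_nonneg mult_left_mono lip[OF s])
    also have "\<dots> \<le> L * (\<epsilon> / 2 * fejer_kernel N (r - s) + 2 / (real N * \<epsilon>))"
      using mult_left_mono[OF fejer_kernel_times_chord[OF \<open>N > 0\<close> \<open>\<epsilon> > 0\<close>, of "r - s"] \<open>L \<ge> 0\<close>]
      by (simp only: mult_ac)
    finally show "norm (fejer_kernel N (r - s) *\<^sub>R (g s - g r)) \<le>
        L * (\<epsilon> / 2 * fejer_kernel N (r - s) + 2 / (real N * \<epsilon>))" .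
  qed (intro ints)+
  also have "\<dots> = L * (\<epsilon> / 2 + 2 / (real N * \<epsilon>))"
  proof -
    have "((\<lambda>s. L * (\<epsilon> / 2 * fejer_kernel N (r - s) + 2 / (real N * \<epsilon>))) has_integral
        L * (\<epsilon> / 2 * 1 + 2 / (real N * \<epsilon>) * (1 - 0))) {0..1}"
      using has_integral_const_real[of "2 / (real N * \<epsilon>)" 0 1] K1
      by (intro has_integral_mult_right has_integral_add) (simp_all add: mult.commute)
    from integral_unique[OF this] show ?thesis by (simp only: mult_1_right diff_zero)
  qed
  finally show ?thesis .
qed

text \<open>The pairing gives squared norms of coefficients, summed over all pairs (j, l). In each
  of the \<open>N\<close> rows the frequencies are distinct, so \<open>B\<close> bounds the row, and
  the division by \<open>N\<close> leaves \<open>B\<close>.\<close>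

lemma integral_rinner_fejer_mean:
  fixes g :: "real \<Rightarrow> 'a::complex_hilbert_space"
  assumes g: "continuous_on {0..1} g" and "N > 0"
    and B: "\<And>F. finite F \<Longrightarrow> (\<Sum>k\<in>F. (norm (fourier_coeff g k))\<^sup>2) \<le> B"
  shows "integral {0..1} (\<lambda>r. rinner (fejer_mean N g r) (g r)) \<le> B"
proof -
  have "rinner (fejer_mean N g r) (g r) = (\<Sum>j<N. \<Sum>l<N.
        rinner (g r) (unit_exp (int j - int l) r *\<^sub>C fourier_coeff g (int j - int l))) / real N" for r
    by (subst rinner_commute) (simp add: fejer_mean_def rinner.scaleR_right rinner.sum_right divide_inverse_commute)
  then have "integral {0..1} (\<lambda>r. rinner (fejer_mean N g r) (g r)) =
      integral {0..1} (\<lambda>r. (\<Sum>j<N. \<Sum>l<N.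
        rinner (g r) (unit_exp (int j - int l) r *\<^sub>C fourier_coeff g (int j - int l)))) / real N"
    by simp
  also have "integral {0..1} (\<lambda>r. (\<Sum>j<N. \<Sum>l<N.
        rinner (g r) (unit_exp (int j - int l) r *\<^sub>C fourier_coeff g (int j - int l)))) =
      (\<Sum>j<N. \<Sum>l<N. integral {0..1} (\<lambda>r.
        rinner (g r) (unit_exp (int j - int l) r *\<^sub>C fourier_coeff g (int j - int l))))"
    by (subst integral_sum, simp, intro integrable_continuous_real continuous_intros g,
      intro sum.cong refl integral_sum finite_lessThan integrable_continuous_real continuous_intros g)
  also have "\<dots> = (\<Sum>j<N. \<Sum>l<N. (norm (fourier_coeff g (int j - int l)))\<^sup>2)"
    by (simp add: integral_rinner_unit_exp[OF g] rinner_self)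
  also have "\<dots> \<le> (\<Sum>j<N. B)"
  proof (rule sum_mono)
    fix j
    have "inj_on (\<lambda>l. int j - int l) {..<N}" by (auto simp: inj_on_def)
    then show "(\<Sum>l<N. (norm (fourier_coeff g (int j - int l)))\<^sup>2) \<le> B"
      using B[of "(\<lambda>l. int j - int l) ` {..<N}"] by (simp add: sum.reindex)
  qed
  finally show ?thesis using \<open>N > 0\<close> by (simp add: field_simps)
qed

text \<open>The Lipschitz condition is with respect to the chordal distance on the circle, so that
  the product of the Fejer kernel with the squared distance is \<open>O(1/N)\<close>.\<close>

lemma parseval_lower_bound:
  fixes g :: "real \<Rightarrow> 'a::complex_hilbert_space"
  assumes g: "continuous_on {0..1} g"
    and lip: "\<And>s r. s \<in> {0..1} \<Longrightarrow> r \<in> {0..1} \<Longrightarrow> norm (g s - g r) \<le> L * cmod (unit_exp 1 (r - s) - 1)"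
    and "L \<ge> 0"
    and B: "\<And>F. finite F \<Longrightarrow> (\<Sum>k\<in>F. (norm (fourier_coeff g k))\<^sup>2) \<le> B"
  shows "integral {0..1} (\<lambda>s. (norm (g s))\<^sup>2) \<le> B"
proof -
  note ints = integrable_continuous_real continuous_intros g
  have "bounded (g ` {0..1})"
    by (intro compact_imp_bounded compact_continuous_image g) simp
  then obtain G where "\<forall>x\<in>g ` {0..1}. norm x \<le> G"
    unfolding bounded_iff by blast
  then have G: "norm (g s) \<le> G" if "s \<in> {0..1}" for s
    using that by blast
  have "G \<ge> 0" using order_trans[OF norm_ge_zero G[of 0]] by simp
  have bound: "integral {0..1} (\<lambda>s. (norm (g s))\<^sup>2) \<le> B + L * G * (5 / 2) * inverse (real (Suc n))" for n
  proof -
    \<comment> \<open>With \<epsilon> = 1/(n+1) this choice makes both error terms multiples of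
      1/(n+1); the constant is 5/2 = 1/2 + 2.\<close>
    define N where "N = Suc n ^ 2"
    have "N > 0" by (simp add: N_def)
    have "inverse x / 2 + 2 / (x\<^sup>2 * inverse x) = (5 / 2) * inverse x" if "x > 0" for x :: real
      using that by (simp add: power2_eq_square field_simps)
    from this[of "real (Suc n)"]
    have "L * (inverse (real (Suc n)) / 2 + 2 / (real N * inverse (real (Suc n)))) = L * (5 / 2) * inverse (real (Suc n))"
      by (simp only: N_def of_nat_power mult.assoc)
    moreover have "norm (fejer_mean N g r - g r) \<le>
        L * (inverse (real (Suc n)) / 2 + 2 / (real N * inverse (real (Suc n))))" if "r \<in> {0..1}" for r
      by (rule norm_fejer_mean_diff[OF g lip \<open>L \<ge> 0\<close> \<open>N > 0\<close>]) (use that in auto)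
    ultimately have close: "norm (fejer_mean N g r - g r) \<le> L * (5 / 2) * inverse (real (Suc n))" if "r \<in> {0..1}" for r
      using that by (simp only:)
    have "integral {0..1} (\<lambda>s. (norm (g s))\<^sup>2) \<le>
        integral {0..1} (\<lambda>s. rinner (fejer_mean N g s) (g s) + L * (5 / 2) * inverse (real (Suc n)) * G)"
    proof (rule integral_le)
      fix s :: real assume s: "s \<in> {0..1}"
      have "(norm (g s))\<^sup>2 = rinner (fejer_mean N g s) (g s) + rinner (g s - fejer_mean N g s) (g s)"
        by (simp add: rinner.diff_left rinner_self)
      also have "rinner (g s - fejer_mean N g s) (g s) \<le> norm (fejer_mean N g s - g s) * norm (g s)"
        using rinner_le[of "g s - fejer_mean N g s" "g s"] by (simp add: norm_minus_commute)
      also have "\<dots> \<le> L * (5 / 2) * inverse (real (Suc n)) * G"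
        by (intro mult_mono close[OF s] G[OF s]) (use \<open>L \<ge> 0\<close> in auto)
      finally show "(norm (g s))\<^sup>2 \<le> rinner (fejer_mean N g s) (g s) + L * (5 / 2) * inverse (real (Suc n)) * G"
        by simp
    qed (intro ints)+
    also have "\<dots> = integral {0..1} (\<lambda>s. rinner (fejer_mean N g s) (g s)) + L * (5 / 2) * inverse (real (Suc n)) * G"
      by (subst integral_add; (intro ints)?) simp
    also have "integral {0..1} (\<lambda>s. rinner (fejer_mean N g s) (g s)) \<le> B"
      by (rule integral_rinner_fejer_mean[OF g \<open>N > 0\<close> B])
    finally show ?thesis by (simp add: mult_ac)
  qed
  have "(\<lambda>n. B + L * G * (5 / 2) * inverse (real (Suc n))) \<longlonglongrightarrow> B + L * G * (5 / 2) * 0"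
    by (intro tendsto_intros LIMSEQ_inverse_real_of_nat)
  then show ?thesis
    using LIMSEQ_le_const[of _ B] bound by auto
qed

text \<open>The chord is 2 |sin(pi u)|, the left side the distance from \<open>u\<close> to the
  nearest integer. For 0 \<le> v \<le> 1/2 and x = pi v \<le> 2, Taylor gives sin x \<ge> x - x^3/6
  \<ge> x/3, and x \<ge> 2v; reflection covers the rest. The constant 1 is crude, which is harmless:
  the Lipschitz constant disappears in the limit in \<open>parseval_lower_bound\<close>.\<close>

lemma chord_lower_bound:
  assumes "\<bar>u\<bar> \<le> 1"
  shows "min \<bar>u\<bar> (1 - \<bar>u\<bar>) \<le> cmod (unit_exp 1 u - 1)"
proof -
  have half: "v \<le> cmod (unit_exp 1 v - 1)" if "0 \<le> v" "v \<le> 1/2" for v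
  proof -
    define x where "x = pi * v"
    have x: "0 \<le> x" "x \<le> 2" "2 * v \<le> x"
    proof -
      show "0 \<le> x" using that by (simp add: x_def)
      show "x \<le> 2" using mult_mono[of pi 4 v "1/2"] that pi_less_4 by (simp add: x_def)
      show "2 * v \<le> x" unfolding x_def by (rule mult_right_mono) (use that pi_ge_two in auto)
    qed
    have "\<bar>sin x - x\<bar> \<le> x ^ 3 / 6"
      using Maclaurin_sin_bound[of x 3] x by (simp add: numeral_3_eq_3 sin_coeff_def field_simps)
    moreover have "x ^ 3 \<le> 4 * x"
      using mult_right_mono[OF power_mono[of x 2 2] \<open>0 \<le> x\<close>] x by (simp add: power3_eq_cube power2_eq_square)
    ultimately have "x / 3 \<le> sin x" by (auto simp: abs_if split: if_splits)
    then have "v \<le> 2 * sin x" using x by simp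
    have "unit_exp 1 v = cis x * cis x"
      by (simp add: unit_exp_def x_def cis_mult mult.assoc)
    then have "unit_exp 1 v - 1 = cis x * (cis x - cnj (cis x))"
      by (simp add: algebra_simps cis_cnj cis_mult)
    then have "cmod (unit_exp 1 v - 1) = cmod (cis x - cnj (cis x))"
      by (simp add: norm_mult)
    also have "\<dots> = \<bar>2 * sin x\<bar>"
      by (simp add: complex_diff_cnj norm_mult)
    finally show ?thesis using \<open>v \<le> 2 * sin x\<close> by simp
  qed
  have sym: "cmod (unit_exp 1 (- v) - 1) = cmod (unit_exp 1 v - 1)" for v
    by (metis cnj_unit_exp unit_exp_uminus complex_cnj_diff complex_cnj_one complex_mod_cnj)
  have pos: "min v (1 - v) \<le> cmod (unit_exp 1 v - 1)" if "0 \<le> v" "v \<le> 1" for v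
  proof (cases "v \<le> 1/2")
    case True
    then show ?thesis using half[of v] that by simp
  next
    case False
    have "unit_exp 1 (1 - v) = unit_exp 1 (- v)"
      using unit_exp_plus[of 1 1 "-v"] by simp
    then show ?thesis using half[of "1 - v"] sym[of v] that False by simp
  qed
  show ?thesis
    using pos[of "\<bar>u\<bar>"] sym[of u] assms by (cases "u \<ge> 0") auto
qed

text \<open>As \<open>g 0 = g 1\<close>, two points can also be joined through the common end value,
  along an arc of length 1 - |r - s|. So \<open>g\<close> is Lipschitz for the arc distance, which
  the chord dominates.\<close>

lemma lipschitz_chord:
  fixes g :: "real \<Rightarrow> 'a::real_normed_vector"
  assumes lip: "\<And>s r. s \<in> {0..1} \<Longrightarrow> r \<in> {0..1} \<Longrightarrow> norm (g s - g r) \<le> L * \<bar>s - r\<bar>"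
    and "L \<ge> 0" and per: "g 0 = g 1" and s: "s \<in> {0..1}" and r: "r \<in> {0..1}"
  shows "norm (g s - g r) \<le> L * cmod (unit_exp 1 (r - s) - 1)"
proof -
  have wrap: "norm (g s - g r) \<le> L * (1 - (r - s))" if "s \<in> {0..1}" "r \<in> {0..1}" for s r
  proof -
    have "norm (g s - g r) \<le> norm (g s - g 0) + norm (g 1 - g r)"
      using norm_triangle_ineq[of "g s - g 0" "g 1 - g r"] per by simp
    also have "\<dots> \<le> L * \<bar>s - 0\<bar> + L * \<bar>1 - r\<bar>"
      using that by (intro add_mono lip) auto
    finally show ?thesis using that by (simp add: algebra_simps)
  qed
  have "norm (g s - g r) \<le> L * (1 - \<bar>r - s\<bar>)"
    using wrap[OF s r] wrap[OF r s] by (auto simp: abs_if norm_minus_commute)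
  moreover have "norm (g s - g r) \<le> L * \<bar>r - s\<bar>"
    using lip[OF s r] by (simp add: abs_minus_commute)
  ultimately have "norm (g s - g r) \<le> L * min \<bar>r - s\<bar> (1 - \<bar>r - s\<bar>)"
    by (simp add: min_def)
  also have "\<dots> \<le> L * cmod (unit_exp 1 (r - s) - 1)"
    by (intro mult_left_mono chord_lower_bound \<open>L \<ge> 0\<close>) (use s r in auto)
  finally show ?thesis .
qed

section \<open>Bounded semigroups, generators and resolvents\<close>

text \<open>The limit that arises when the generator is applied to the integral of an orbit.\<close>

lemma right_derivative_integral:
  fixes f :: "real \<Rightarrow> 'a::banach"
  assumes f: "continuous_on {a..} f"
  shows "((\<lambda>h. integral {a..a + h} f /\<^sub>R h) \<longlongrightarrow> f a) (at_right 0)"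
proof -
  have "continuous_on {a..a + 1} f"
    using f by (rule continuous_on_subset) auto
  then have "((\<lambda>u. integral {a..u} f) has_vector_derivative f a) (at a within {a..a + 1})"
    by (rule integral_has_vector_derivative) simp
  then have "((\<lambda>u. (1 / norm (u - a)) *\<^sub>R (integral {a..u} f - (u - a) *\<^sub>R f a)) \<longlongrightarrow> 0) (at a within {a..a + 1})"
    by (simp add: has_vector_derivative_def has_derivative_within)
  moreover have "filterlim (\<lambda>h. a + h) (at a within {a..a + 1}) (at_right 0)"
    unfolding filterlim_at
  proof
    show "\<forall>\<^sub>F h in at_right 0. a + h \<in> {a..a + 1} \<and> a + h \<noteq> a"
      by (rule eventually_at_rightI[of 0 1]) auto
    show "((+) a \<longlongrightarrow> a) (at_right 0)"
      by (rule tendsto_eq_intros refl | simp)+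
  qed
  ultimately have "((\<lambda>h. (1 / norm h) *\<^sub>R (integral {a..a + h} f - h *\<^sub>R f a)) \<longlongrightarrow> 0) (at_right 0)"
    using filterlim_compose[of _ "nhds 0" "at a within {a..a + 1}" "(+) a" "at_right 0"] by force
  then have "((\<lambda>h. (1 / norm h) *\<^sub>R (integral {a..a + h} f - h *\<^sub>R f a) + f a) \<longlongrightarrow> 0 + f a) (at_right 0)"
    by (intro tendsto_intros)
  moreover have "\<forall>\<^sub>F h in at_right 0. (1 / norm h) *\<^sub>R (integral {a..a + h} f - h *\<^sub>R f a) + f a = integral {a..a + h} f /\<^sub>R h"
    by (rule eventually_at_rightI[of 0 1]) (auto simp: scaleR_diff_right divide_inverse)
  ultimately show ?thesis
    by (simp add: Lim_transform_eventually)
qed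

text \<open>The product rule at 0. It is stated for a bare family \<open>T\<close>, because
  \<open>rescale\<close> applies it a second time, to the rescaled family, in order to undo the
  rescaling.\<close>

lemma quotient_rescale:
  fixes T :: "real \<Rightarrow> 'a::complex_hilbert_space \<Rightarrow> 'a"
  assumes "t > 0" and lim: "((\<lambda>h. (T h x - x) /\<^sub>R h) \<longlongrightarrow> y) (at_right 0)"
  shows "((\<lambda>h. (exp (- (w * complex_of_real h)) *\<^sub>C T (t * h) x - x) /\<^sub>R h) \<longlongrightarrow> t *\<^sub>R y - w *\<^sub>C x) (at_right 0)"
proof -
  have of_real_lim: "filterlim complex_of_real (at 0) (at_right 0)"
    unfolding filterlim_at
    by (auto intro!: tendsto_eq_intros eventually_at_rightI[of 0 1])
  have scale_lim: "filterlim (\<lambda>h. t * h) (at_right 0) (at_right 0)"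
    unfolding filterlim_at
    using \<open>t > 0\<close> by (auto intro!: tendsto_eq_intros eventually_at_rightI[of 0 1])
  have "((\<lambda>z. exp (- (w * z))) has_field_derivative - w) (at 0)"
    by (auto intro!: derivative_eq_intros)
  then have "((\<lambda>z. (exp (- (w * z)) - 1) / z) \<longlongrightarrow> - w) (at 0)"
    by (simp add: DERIV_def)
  then have exp_quot: "((\<lambda>h. (exp (- (w * complex_of_real h)) - 1) / complex_of_real h) \<longlongrightarrow> - w) (at_right 0)"
    by (rule filterlim_compose[OF _ of_real_lim])
  have "((\<lambda>h. (T (t * h) x - x) /\<^sub>R (t * h)) \<longlongrightarrow> y) (at_right 0)"
    by (rule filterlim_compose[OF lim scale_lim])
  moreover have "((\<lambda>h. exp (- (w * complex_of_real h))) \<longlongrightarrow> 1) (at_right 0)"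
    by (auto intro!: tendsto_eq_intros)
  ultimately have lim': "((\<lambda>h. exp (- (w * complex_of_real h)) *\<^sub>C (t *\<^sub>R ((T (t * h) x - x) /\<^sub>R (t * h))) +
      ((exp (- (w * complex_of_real h)) - 1) / complex_of_real h) *\<^sub>C x) \<longlongrightarrow> 1 *\<^sub>C (t *\<^sub>R y) + (- w) *\<^sub>C x) (at_right 0)"
    by (intro tendsto_add scaleC.tendsto tendsto_scaleR exp_quot tendsto_const)
  have eq: "exp (- (w * complex_of_real h)) *\<^sub>C (t *\<^sub>R ((T (t * h) x - x) /\<^sub>R (t * h))) +
      ((exp (- (w * complex_of_real h)) - 1) / complex_of_real h) *\<^sub>C x =
      (exp (- (w * complex_of_real h)) *\<^sub>C T (t * h) x - x) /\<^sub>R h" if "h > 0" for h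
  proof -
    have "((exp (- (w * complex_of_real h)) - 1) / complex_of_real h) *\<^sub>C x =
        (exp (- (w * complex_of_real h)) *\<^sub>C x - x) /\<^sub>R h"
      by (simp add: scaleR_scaleC scaleC_scaleC scaleC_one divide_inverse mult.commute
          scaleC.diff_left scaleC.diff_right algebra_simps)
    then show ?thesis
      using that \<open>t > 0\<close>
      by (simp add: scaleC.scaleR_right scaleC.diff_right scaleR_diff_right mult.commute[of t] mult.assoc)
  qed
  have "\<forall>\<^sub>F h in at_right 0. exp (- (w * complex_of_real h)) *\<^sub>C (t *\<^sub>R ((T (t * h) x - x) /\<^sub>R (t * h))) +
      ((exp (- (w * complex_of_real h)) - 1) / complex_of_real h) *\<^sub>C x =
      (exp (- (w * complex_of_real h)) *\<^sub>C T (t * h) x - x) /\<^sub>R h"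
    by (rule eventually_at_rightI[of 0 1], rule eq) auto
  from Lim_transform_eventually[OF lim' this] show ?thesis
    by (simp add: scaleC_one scaleC.minus_left)
qed

locale bounded_C0_semigroup =
  fixes T :: "real \<Rightarrow> 'a::complex_hilbert_space \<Rightarrow> 'a" and D :: "'a set" and A :: "'a \<Rightarrow> 'a" and K :: real
  assumes C0: "C0_semigroup T" and gen: "is_generator T D A"
    and norm_T: "t \<ge> 0 \<Longrightarrow> norm (T t x) \<le> K * norm x"
    and K_ge_1: "K \<ge> 1"
begin

lemma bounded_linear_T: "t \<ge> 0 \<Longrightarrow> bounded_linear (T t)"
  using C0 by (simp add: C0_semigroup_def bounded_clinear_def)

lemma T_scaleC: "t \<ge> 0 \<Longrightarrow> T t (c *\<^sub>C x) = c *\<^sub>C T t x"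
  using C0 by (simp add: C0_semigroup_def bounded_clinear_def)

lemma T_diff: "t \<ge> 0 \<Longrightarrow> T t (x - y) = T t x - T t y"
  by (metis bounded_linear_T linear_diff bounded_linear.linear)

lemma T_scaleR: "t \<ge> 0 \<Longrightarrow> T t (r *\<^sub>R x) = r *\<^sub>R T t x"
  by (simp add: scaleR_scaleC T_scaleC)

lemma T_0 [simp]: "T 0 x = x"
  using C0 by (simp add: C0_semigroup_def)

lemma T_add: "s \<ge> 0 \<Longrightarrow> t \<ge> 0 \<Longrightarrow> T (s + t) x = T s (T t x)"
  using C0 by (simp add: C0_semigroup_def)

lemma T_tendsto: "((\<lambda>t. T t x) \<longlongrightarrow> x) (at_right 0)" 
  using C0 by (simp add: C0_semigroup_def)

lemma A_tendsto: "v \<in> D \<Longrightarrow> ((\<lambda>h. (T h v - v) /\<^sub>R h) \<longlongrightarrow> A v) (at_right 0)"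
  using gen by (simp add: is_generator_def)

lemma D_A_I:
  assumes "((\<lambda>h. (T h x - x) /\<^sub>R h) \<longlongrightarrow> y) (at_right 0)"
  shows "x \<in> D" "A x = y"
proof -
  show "x \<in> D" using gen assms by (auto simp: is_generator_def)
  then show "A x = y"
    using A_tendsto assms by (intro tendsto_unique[of "at_right (0::real)"]) auto
qed

lemma A_add: assumes "u \<in> D" "v \<in> D" shows "u + v \<in> D" "A (u + v) = A u + A v"
proof -
  have "((\<lambda>h. (T h u - u) /\<^sub>R h + (T h v - v) /\<^sub>R h) \<longlongrightarrow> A u + A v) (at_right 0)"
    by (intro tendsto_intros A_tendsto assms)
  moreover have "\<forall>\<^sub>F h in at_right 0. (T h u - u) /\<^sub>R h + (T h v - v) /\<^sub>R h = (T h (u + v) - (u + v)) /\<^sub>R h"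
    by (rule eventually_at_rightI[of 0 1])
       (auto simp: linear_add[OF bounded_linear.linear[OF bounded_linear_T]] algebra_simps)
  ultimately have "((\<lambda>h. (T h (u + v) - (u + v)) /\<^sub>R h) \<longlongrightarrow> A u + A v) (at_right 0)"
    by (rule Lim_transform_eventually)
  then show "u + v \<in> D" "A (u + v) = A u + A v" by (rule D_A_I)+
qed

lemma A_scaleC: assumes "v \<in> D" shows "c *\<^sub>C v \<in> D" "A (c *\<^sub>C v) = c *\<^sub>C A v"
proof -
  have "((\<lambda>h. c *\<^sub>C ((T h v - v) /\<^sub>R h)) \<longlongrightarrow> c *\<^sub>C A v) (at_right 0)"
    by (intro scaleC.tendsto tendsto_const A_tendsto assms)
  moreover have "\<forall>\<^sub>F h in at_right 0. c *\<^sub>C ((T h v - v) /\<^sub>R h) = (T h (c *\<^sub>C v) - c *\<^sub>C v) /\<^sub>R h"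
    by (rule eventually_at_rightI[of 0 1])
       (auto simp: T_scaleC scaleC.diff_right scaleC.scaleR_right)
  ultimately have "((\<lambda>h. (T h (c *\<^sub>C v) - c *\<^sub>C v) /\<^sub>R h) \<longlongrightarrow> c *\<^sub>C A v) (at_right 0)"
    by (rule Lim_transform_eventually)
  then show "c *\<^sub>C v \<in> D" "A (c *\<^sub>C v) = c *\<^sub>C A v" by (rule D_A_I)+
qed

lemma A_diff: assumes "u \<in> D" "v \<in> D" shows "u - v \<in> D" "A (u - v) = A u - A v"
proof -
  have "u - v = u + (-1) *\<^sub>C v" by (simp add: scaleC.minus_left scaleC_one)
  then show "u - v \<in> D" "A (u - v) = A u - A v"
    using A_add[of u "(-1) *\<^sub>C v"] A_scaleC[of v "-1"] assms
    by (simp_all add: scaleC.minus_left scaleC_one)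
qed

lemma T_D: assumes "v \<in> D" "t \<ge> 0" shows "T t v \<in> D" "A (T t v) = T t (A v)"
proof -
  have "((\<lambda>h. T t ((T h v - v) /\<^sub>R h)) \<longlongrightarrow> T t (A v)) (at_right 0)"
    by (intro bounded_linear.tendsto[OF bounded_linear_T] A_tendsto assms)
  moreover have "\<forall>\<^sub>F h in at_right 0. T t ((T h v - v) /\<^sub>R h) = (T h (T t v) - T t v) /\<^sub>R h"
    using \<open>t \<ge> 0\<close> T_add
    by (intro eventually_at_rightI[of 0 1])
       (auto simp: T_scaleR T_diff simp flip: T_add, simp add: add.commute)
  ultimately have "((\<lambda>h. (T h (T t v) - T t v) /\<^sub>R h) \<longlongrightarrow> T t (A v)) (at_right 0)"
    by (rule Lim_transform_eventually)
  then show "T t v \<in> D" "A (T t v) = T t (A v)" by (rule D_A_I)+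
qed

text \<open>Right continuity at 0 spreads to all times: the difference of two orbit values is
  \<open>T\<close> at the earlier time applied to \<open>T (b - a) x - x\<close>, and
  \<open>K\<close> bounds that operator uniformly.\<close>

lemma continuous_on_T: "continuous_on {0..} (\<lambda>t. T t x)"
  unfolding continuous_on_iff
proof (intro ballI allI impI)
  fix t e :: real assume "t \<in> {0..}" "e > 0"
  have diff: "norm (T b x - T a x) \<le> K * norm (T (b - a) x - x)" if "0 \<le> a" "a \<le> b" for a b
    using norm_T[of a "T (b - a) x - x"] that T_add[of a "b - a" x] by (simp add: T_diff)
  have "e / K > 0" using \<open>e > 0\<close> K_ge_1 by simp
  then have "\<forall>\<^sub>F h in at_right 0. dist (T h x) x < e / K"
    by (rule tendstoD[OF T_tendsto])
  then obtain d where "d > 0"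
    and d: "\<And>h. 0 < h \<Longrightarrow> h < d \<Longrightarrow> norm (T h x - x) < e / K"
    by (auto simp: eventually_at_right_field dist_norm)
  have close: "norm (T b x - T a x) < e" if "0 \<le> a" "a \<le> b" "b - a < d" for a b
  proof (cases "a = b")
    case False
    have "K * norm (T (b - a) x - x) < e"
      using d[of "b - a"] that False K_ge_1 by (simp add: field_simps)
    then show ?thesis using diff[OF that(1,2)] by simp
  qed (use \<open>e > 0\<close> in simp)
  show "\<exists>d>0. \<forall>t'\<in>{0..}. dist t' t < d \<longrightarrow> dist (T t' x) (T t x) < e"
  proof (intro exI conjI ballI impI)
    fix t' assume "t' \<in> {0..}" "dist t' t < d"
    then show "dist (T t' x) (T t x) < e"
      using close[of t t'] close[of t' t] \<open>t \<in> {0..}\<close>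
      by (cases "t \<le> t'") (auto simp: dist_norm norm_minus_commute)
  qed (rule \<open>d > 0\<close>)
qed

lemma continuous_on_T' [continuous_intros]:
  "continuous_on S f \<Longrightarrow> (\<And>s. s \<in> S \<Longrightarrow> 0 \<le> f s) \<Longrightarrow> continuous_on S (\<lambda>s. T (f s) x)"
  by (rule continuous_on_compose2[OF continuous_on_T]) auto

lemma integrable_T: "0 \<le> a \<Longrightarrow> (\<lambda>s. T s x) integrable_on {a..b}"
  by (intro integrable_continuous_real continuous_intros) auto

text \<open>Shifting the integral by h leaves only two end intervals of length h, so the difference
  quotient is a difference of two mean values. This is the source of vectors in
  \<open>D\<close>.\<close>

lemma A_integral_T:
  assumes "\<tau> \<ge> 0"
  shows "integral {0..\<tau>} (\<lambda>s. T s x) \<in> D" "A (integral {0..\<tau>} (\<lambda>s. T s x)) = T \<tau> x - x"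
proof -
  define F where "F \<tau> = integral {0..\<tau>} (\<lambda>s. T s x)" for \<tau>
  have eq: "T h (F \<tau>) - F \<tau> = integral {\<tau>..\<tau> + h} (\<lambda>s. T s x) - integral {0..0 + h} (\<lambda>s. T s x)" if "h > 0" for h
  proof -
    have "T h (F \<tau>) = integral {0..\<tau>} (\<lambda>s. T h (T s x))"
      unfolding F_def using integral_linear[OF integrable_T bounded_linear_T, of 0 h \<tau> x] that
      by (simp add: o_def)
    also have "\<dots> = integral {0..\<tau>} ((\<lambda>s. T s x) \<circ> (+) h)"
      by (rule integral_cong) (use that in \<open>simp add: T_add\<close>)
    also have "\<dots> = integral {h..\<tau> + h} (\<lambda>s. T s x)"
      using integral_shift_Icc_real[of 0 \<tau> "\<lambda>s. T s x" h] by simp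
    finally have "T h (F \<tau>) + integral {0..h} (\<lambda>s. T s x) = F \<tau> + integral {\<tau>..\<tau> + h} (\<lambda>s. T s x)"
      unfolding F_def
      using Henstock_Kurzweil_Integration.integral_combine[OF _ _ integrable_T[OF order_refl], of h "\<tau> + h" x]
        Henstock_Kurzweil_Integration.integral_combine[OF _ _ integrable_T[OF order_refl], of \<tau> "\<tau> + h" x] that assms
      by (simp add: add.commute)
    then show ?thesis by (simp add: algebra_simps)
  qed
  have "((\<lambda>h. integral {\<tau>..\<tau> + h} (\<lambda>s. T s x) /\<^sub>R h - integral {0..0 + h} (\<lambda>s. T s x) /\<^sub>R h) \<longlongrightarrow> T \<tau> x - T 0 x) (at_right 0)"
    by (intro tendsto_diff right_derivative_integral continuous_intros) (use assms in auto)
  moreover have "\<forall>\<^sub>F h in at_right 0. integral {\<tau>..\<tau> + h} (\<lambda>s. T s x) /\<^sub>R h - integral {0..0 + h} (\<lambda>s. T s x) /\<^sub>R h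
      = (T h (F \<tau>) - F \<tau>) /\<^sub>R h"
    by (rule eventually_at_rightI[of 0 1]) (auto simp: eq scaleR_diff_right)
  ultimately have "((\<lambda>h. (T h (F \<tau>) - F \<tau>) /\<^sub>R h) \<longlongrightarrow> T \<tau> x - T 0 x) (at_right 0)"
    by (rule Lim_transform_eventually)
  from D_A_I[OF this] show "integral {0..\<tau>} (\<lambda>s. T s x) \<in> D" "A (integral {0..\<tau>} (\<lambda>s. T s x)) = T \<tau> x - x"
    by (simp_all add: F_def)
qed

text \<open>The operator \<open>F\<close> is bounded and commutes with \<open>T h\<close>, so
  \<open>A (F v) = F (A v)\<close>, while \<open>A_integral_T\<close> evaluates
  \<open>A (F v)\<close>. Only right derivatives go in; the derivative from both sides comes out in
  \<open>T_has_vector_derivative\<close>.\<close>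

lemma integral_T_A:
  assumes "\<tau> \<ge> 0" "v \<in> D"
  shows "integral {0..\<tau>} (\<lambda>s. T s (A v)) = T \<tau> v - v"
proof -
  define F where "F x = integral {0..\<tau>} (\<lambda>s. T s x)" for x
  have "bounded_linear F"
  proof (rule bounded_linear_intro[where K="K * \<tau>"])
    fix x y and r :: real
    show "F (x + y) = F x + F y"
      unfolding F_def by (subst integral_add[symmetric]; (rule integrable_T)?)
        (auto intro!: integral_cong simp: linear_add[OF bounded_linear.linear[OF bounded_linear_T]])
    show "F (r *\<^sub>R x) = r *\<^sub>R F x"
      unfolding F_def integral_cmul[symmetric] by (rule integral_cong) (simp add: T_scaleR)
    have "norm (F x) \<le> integral {0..\<tau>} (\<lambda>s. K * norm x)"
      unfolding F_def by (intro integral_norm_bound_integral integrable_T) (auto simp: norm_T)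
    then show "norm (F x) \<le> norm x * (K * \<tau>)" using assms by (simp add: mult_ac)
  qed
  then have "((\<lambda>h. F ((T h v - v) /\<^sub>R h)) \<longlongrightarrow> F (A v)) (at_right 0)"
    by (rule bounded_linear.tendsto) (intro A_tendsto assms)
  moreover have "\<forall>\<^sub>F h in at_right 0. F ((T h v - v) /\<^sub>R h) = (T h (F v) - F v) /\<^sub>R h"
  proof (rule eventually_at_rightI[of 0 1])
    fix h :: real assume h: "h \<in> {0<..<1}"
    have "T h (F v) = integral {0..\<tau>} (\<lambda>s. T h (T s v))"
      unfolding F_def using integral_linear[OF integrable_T bounded_linear_T, of 0 h \<tau> v] h
      by (simp add: o_def)
    also have "\<dots> = F (T h v)"
      unfolding F_def by (rule integral_cong) (use h in \<open>simp add: add.commute flip: T_add\<close>)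
    finally show "F ((T h v - v) /\<^sub>R h) = (T h (F v) - F v) /\<^sub>R h"
      using \<open>bounded_linear F\<close> by (simp add: linear_diff linear_scale bounded_linear.linear)
  qed simp
  ultimately have "((\<lambda>h. (T h (F v) - F v) /\<^sub>R h) \<longlongrightarrow> F (A v)) (at_right 0)"
    by (rule Lim_transform_eventually)
  from D_A_I(2)[OF this] show ?thesis
    using A_integral_T(2)[OF \<open>\<tau> \<ge> 0\<close>, of v] by (simp add: F_def)
qed

lemma T_has_vector_derivative:
  assumes "v \<in> D" "t \<in> {0..b}"
  shows "((\<lambda>s. T s v) has_vector_derivative T t (A v)) (at t within {0..b})"
proof -
  have "((\<lambda>u. integral {0..u} (\<lambda>s. T s (A v))) has_vector_derivative T t (A v)) (at t within {0..b})"
    using \<open>t \<in> {0..b}\<close> by (intro integral_has_vector_derivative continuous_intros) auto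
  then have "((\<lambda>u. v + integral {0..u} (\<lambda>s. T s (A v))) has_vector_derivative 0 + T t (A v)) (at t within {0..b})"
    by (intro has_vector_derivative_add has_vector_derivative_const)
  then show ?thesis
    by (simp, elim has_vector_derivative_transform[rotated 2])
       (use assms integral_T_A in auto)
qed

end

section \<open>Rescaled and exponentially decaying semigroups\<close>

lemma integral_exp_neg_le:
  fixes a \<tau> :: real
  assumes "a > 0" "\<tau> \<ge> 0"
  shows "(\<lambda>s. exp (- a * s)) integrable_on {0..\<tau>}" "integral {0..\<tau>} (\<lambda>s. exp (- a * s)) \<le> 1 / a"
proof -
  have "((\<lambda>s. - exp (- a * s) / a) has_vector_derivative exp (- a * s)) (at s within {0..\<tau>})" for s
    using \<open>a > 0\<close> by (auto intro!: derivative_eq_intros simp flip: has_real_derivative_iff_has_vector_derivative)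
  then have "((\<lambda>s. exp (- a * s)) has_integral (- exp (- a * \<tau>) / a - - exp (- a * 0) / a)) {0..\<tau>}"
    using \<open>\<tau> \<ge> 0\<close> by (intro fundamental_theorem_of_calculus) auto
  then show "(\<lambda>s. exp (- a * s)) integrable_on {0..\<tau>}" "integral {0..\<tau>} (\<lambda>s. exp (- a * s)) \<le> 1 / a"
    using \<open>a > 0\<close> by (auto simp: integral_unique integrable_on_def)
qed

context bounded_C0_semigroup
begin

text \<open>Since \<open>D\<close> and \<open>K\<close> stay the same, the whole locale becomes
  available for the semigroup generated by t A - w.\<close>

lemma rescale:
  assumes "t > 0" "Re w \<ge> 0"
  shows "bounded_C0_semigroup (\<lambda>s x. exp (- (w * complex_of_real s)) *\<^sub>C T (t * s) x) D
    (\<lambda>x. t *\<^sub>R A x - w *\<^sub>C x) K"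
proof -
  define S where "S s x = exp (- (w * complex_of_real s)) *\<^sub>C T (t * s) x" for s x
  have "bounded_clinear (S s)" if "s \<ge> 0" for s
    unfolding bounded_clinear_def S_def using that \<open>t > 0\<close>
    by (auto intro!: bounded_linear_compose[OF scaleC.bounded_linear_right] bounded_linear_T
        simp: T_scaleC scaleC_scaleC mult.commute)
  moreover have "S 0 = id"
    by (simp add: S_def fun_eq_iff scaleC_one)
  moreover have "S (r + s) = S r \<circ> S s" if "r \<ge> 0" "s \<ge> 0" for r s
    using that \<open>t > 0\<close>
    by (simp add: S_def fun_eq_iff T_scaleC scaleC_scaleC distrib_left T_add exp_add[symmetric] minus_add_distrib)
  moreover have "((\<lambda>s. S s x) \<longlongrightarrow> x) (at_right 0)" for x
  proof -
    have "filterlim (\<lambda>h. t * h) (at_right 0) (at_right 0)"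
      unfolding filterlim_at
      using \<open>t > 0\<close> by (auto intro!: tendsto_eq_intros eventually_at_rightI[of 0 1])
    then have "((\<lambda>s. T (t * s) x) \<longlongrightarrow> x) (at_right 0)"
      by (rule filterlim_compose[OF T_tendsto])
    moreover have "((\<lambda>h. exp (- (w * complex_of_real h))) \<longlongrightarrow> 1) (at_right 0)"
      by (auto intro!: tendsto_eq_intros)
    ultimately have "((\<lambda>s. S s x) \<longlongrightarrow> 1 *\<^sub>C x) (at_right 0)"
      unfolding S_def by (intro scaleC.tendsto)
    then show ?thesis by (simp add: scaleC_one)
  qed
  ultimately have C0_S: "C0_semigroup S"
    by (simp add: C0_semigroup_def)
  have D_S: "((\<lambda>h. (S h x - x) /\<^sub>R h) \<longlongrightarrow> t *\<^sub>R A x - w *\<^sub>C x) (at_right 0)" if "x \<in> D" for x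
    unfolding S_def by (rule quotient_rescale[where T=T, OF \<open>t > 0\<close> A_tendsto[OF that]])
  \<comment> \<open>The domain of the new generator must be exactly \<open>D\<close>. A vector
    differentiable for \<open>S\<close> is differentiable for \<open>T\<close>, because
    \<open>T h\<close> is exp(w h / t) times \<open>S\<close> at time h / t.\<close>
  have "x \<in> D" if "((\<lambda>h. (S h x - x) /\<^sub>R h) \<longlongrightarrow> y) (at_right 0)" for x y
  proof -
    have "exp (- (- (w / complex_of_real t) * complex_of_real h)) *\<^sub>C S (1 / t * h) x = T h x" for h
    proof -
      have "exp (- (- (w / complex_of_real t) * complex_of_real h)) * exp (- (w * complex_of_real (1 / t * h))) = 1"
        using \<open>t > 0\<close> by (simp add: exp_add[symmetric])
      then show ?thesis
        using \<open>t > 0\<close> by (simp only: S_def scaleC_scaleC) (simp add: scaleC_one)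
    qed
    then show ?thesis
      using quotient_rescale[where T=S and t="1 / t" and w="- (w / complex_of_real t)", OF _ that] \<open>t > 0\<close>
      by (intro D_A_I(1)) simp
  qed
  with D_S have "is_generator S D (\<lambda>x. t *\<^sub>R A x - w *\<^sub>C x)"
    by (auto simp: is_generator_def)
  moreover have "norm (S s x) \<le> K * norm x" if "s \<ge> 0" for s x
  proof -
    have "norm (S s x) \<le> 1 * norm (T (t * s) x)"
      unfolding S_def norm_scaleC using that assms by (intro mult_right_mono) auto
    then show ?thesis using norm_T[of "t * s" x] that \<open>t > 0\<close> by simp
  qed
  ultimately show ?thesis
    using C0_S K_ge_1 unfolding S_def[abs_def] by unfold_locales
qed

text \<open>The estimate is the limit \<tau> \<rightarrow> \<infinity> in
  \<open>integral_T_A\<close>, where the term \<open>T \<tau> v\<close> dies out. Surjectivity needs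
  only one finite time.\<close>

lemma decaying_generator:
  assumes decay: "\<And>s x. s \<ge> 0 \<Longrightarrow> norm (T s x) \<le> K * exp (- a * s) * norm x" and "a > 0"
  shows "v \<in> D \<Longrightarrow> norm v \<le> K / a * norm (A v)" and "\<exists>v\<in>D. A v = u"
proof -
  assume "v \<in> D"
  have le: "norm v \<le> K * exp (- a * \<tau>) * norm v + K / a * norm (A v)" if "\<tau> \<ge> 0" for \<tau>
  proof -
    note exp_neg = integral_exp_neg_le[OF \<open>a > 0\<close> \<open>\<tau> \<ge> 0\<close>]
    have "norm (integral {0..\<tau>} (\<lambda>s. T s (A v))) \<le> integral {0..\<tau>} (\<lambda>s. K * norm (A v) * exp (- a * s))"
      by (intro integral_norm_bound_integral integrable_T integrable_on_mult_right exp_neg)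
         (use decay[of _ "A v"] in \<open>auto simp: mult_ac\<close>)
    also have "\<dots> = K * norm (A v) * integral {0..\<tau>} (\<lambda>s. exp (- a * s))"
      by (rule integral_mult_right)
    also have "\<dots> \<le> K * norm (A v) * (1 / a)"
      by (intro mult_left_mono exp_neg) (use K_ge_1 in auto)
    finally have int_le: "norm (integral {0..\<tau>} (\<lambda>s. T s (A v))) \<le> K / a * norm (A v)" by simp
    have "v = T \<tau> v - integral {0..\<tau>} (\<lambda>s. T s (A v))"
      using integral_T_A[OF that \<open>v \<in> D\<close>] by simp
    then have "norm v \<le> norm (T \<tau> v) + norm (integral {0..\<tau>} (\<lambda>s. T s (A v)))"
      by (metis norm_triangle_ineq4)
    with int_le decay[OF that, of v] show ?thesis by simp
  qed
  have "((\<lambda>\<tau>. exp (- (a * \<tau>))) \<longlongrightarrow> 0) at_top"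
    using \<open>a > 0\<close>
    by (intro filterlim_compose[OF exp_at_bot] filterlim_compose[OF filterlim_uminus_at_bot_at_top]
        filterlim_tendsto_pos_mult_at_top[OF tendsto_const] filterlim_ident)
  then have "((\<lambda>\<tau>. K * exp (- a * \<tau>) * norm v + K / a * norm (A v)) \<longlongrightarrow> K * 0 * norm v + K / a * norm (A v)) at_top"
    by (intro tendsto_intros) simp
  then show "norm v \<le> K / a * norm (A v)"
    using tendsto_lowerbound[OF _ eventually_mono[OF eventually_ge_at_top[of 0] le]] by simp
next
  \<comment> \<open>At this time \<open>T \<tau>\<close> contracts by the factor 1/2, so
    \<open>x = T \<tau> x - u\<close> has a solution. Then u = \<open>T \<tau> x - x\<close>, which
    \<open>A_integral_T\<close> exhibits as a value of \<open>A\<close>.\<close>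
  define \<tau> where "\<tau> = ln (2 * K) / a"
  have "\<tau> \<ge> 0" "K * exp (- a * \<tau>) = 1 / 2"
    using K_ge_1 \<open>a > 0\<close> by (auto simp: \<tau>_def exp_minus)
  have "dist (T \<tau> x - u) (T \<tau> y - u) \<le> 1 / 2 * dist x y" for x y
    using decay[OF \<open>\<tau> \<ge> 0\<close>, of "x - y"]
    unfolding \<open>K * exp (- a * \<tau>) = 1 / 2\<close> by (simp add: dist_norm T_diff[OF \<open>\<tau> \<ge> 0\<close>])
  then obtain x where "T \<tau> x - u = x"
    using banach_fix_type[of "1 / 2" "\<lambda>x. T \<tau> x - u"] by auto
  then show "\<exists>v\<in>D. A v = u"
    using A_integral_T[OF \<open>\<tau> \<ge> 0\<close>, of x] by (metis add_diff_cancel_left' diff_add_cancel diff_diff_eq2)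
qed

section \<open>Spectrum and resolvent\<close>

lemma shifted_diff:
  "u \<in> D \<Longrightarrow> v \<in> D \<Longrightarrow> (z *\<^sub>C u - A u) - (z *\<^sub>C v - A v) = z *\<^sub>C (u - v) - A (u - v)"
  by (simp add: A_diff scaleC.diff_right)

text \<open>The lower bound gives injectivity and bounds the inverse by the same \<open>C\<close>;
  linearity of the inverse follows from uniqueness of solutions.\<close>

lemma not_in_spectrumI:
  assumes surj: "\<And>u. \<exists>v\<in>D. z *\<^sub>C v - A v = u"
    and bound: "\<And>v. v \<in> D \<Longrightarrow> norm v \<le> C * norm (z *\<^sub>C v - A v)"
  shows "z \<notin> spectrum D A" "norm (resolvent D A z u) \<le> C * norm u"
proof -
  let ?f = "\<lambda>v. z *\<^sub>C v - A v"
  have inj: "inj_on ?f D"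
  proof (rule inj_onI)
    fix u v assume uv: "u \<in> D" "v \<in> D" "?f u = ?f v"
    then have "?f (u - v) = 0" using shifted_diff[of u v z] by simp
    then show "u = v" using bound[OF A_diff(1)[OF uv(1,2)]] by simp
  qed
  have img: "?f ` D = UNIV" using surj by (metis (no_types, lifting) UNIV_eq_I image_eqI)
  have R_D: "resolvent D A z u \<in> D" and f_R: "?f (resolvent D A z u) = u" for u
    unfolding resolvent_def using inv_into_into[of u ?f D] f_inv_into_f[of u ?f D] img by auto
  have R_eq: "resolvent D A z u = v" if "v \<in> D" "?f v = u" for u v
    using inj R_D f_R that by (metis (no_types, lifting) inj_onD)
  show norm_R: "norm (resolvent D A z u) \<le> C * norm u" for u
    using bound[OF R_D] f_R by metis
  have R_add: "resolvent D A z (u + v) = resolvent D A z u + resolvent D A z v" for u v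
    by (rule R_eq) (use R_D f_R in \<open>simp_all add: A_add scaleC.add_right add_diff_add\<close>)
  have R_scaleC: "resolvent D A z (c *\<^sub>C u) = c *\<^sub>C resolvent D A z u" for c u
  proof (rule R_eq)
    show "c *\<^sub>C resolvent D A z u \<in> D" by (rule A_scaleC(1)[OF R_D])
    have "?f (c *\<^sub>C resolvent D A z u) = c *\<^sub>C ?f (resolvent D A z u)"
      by (simp add: A_scaleC R_D scaleC.diff_right scaleC_scaleC mult.commute)
    then show "?f (c *\<^sub>C resolvent D A z u) = c *\<^sub>C u" by (simp only: f_R)
  qed
  have "bounded_linear (resolvent D A z)"
    by (rule bounded_linear_intro[where K=C]) (use norm_R in \<open>simp_all add: R_add scaleR_scaleC R_scaleC mult.commute\<close>)
  then show "z \<notin> spectrum D A"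
    using inj img R_scaleC by (simp add: spectrum_def bij_betw_def bounded_clinear_def)
qed

text \<open>A - z generates exp(-z s) T(s), which decays at rate \<open>Re z\<close>, so
  \<open>decaying_generator\<close> applies with \<open>a = Re z\<close>.\<close>

lemma right_half_plane:
  assumes "Re z > 0"
  shows "z \<notin> spectrum D A" "norm (resolvent D A z u) \<le> K / Re z * norm u"
proof -
  interpret S: bounded_C0_semigroup "\<lambda>s x. exp (- (z * complex_of_real s)) *\<^sub>C T (1 * s) x" D
    "\<lambda>x. 1 *\<^sub>R A x - z *\<^sub>C x" K
    by (rule rescale) (use assms in auto)
  have decay: "norm (exp (- (z * complex_of_real s)) *\<^sub>C T (1 * s) x) \<le> K * exp (- Re z * s) * norm x"
    if "s \<ge> 0" for s x
    using mult_left_mono[OF norm_T[OF that, of x], of "exp (- Re z * s)"] by (simp add: norm_scaleC mult_ac)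
  have surj: "\<exists>v\<in>D. z *\<^sub>C v - A v = u" for u
    using S.decaying_generator(2)[OF decay assms, of "- u"]
    by (metis add.inverse_inverse minus_diff_eq scaleR_one)
  have bound: "norm v \<le> K / Re z * norm (z *\<^sub>C v - A v)" if "v \<in> D" for v
    using S.decaying_generator(1)[OF decay assms that] by (simp add: norm_minus_commute)
  show "z \<notin> spectrum D A" "norm (resolvent D A z u) \<le> K / Re z * norm u"
    by (rule not_in_spectrumI[OF surj bound]; assumption)+
qed

lemma
  assumes "z \<notin> spectrum D A"
  shows resolvent_in_D: "resolvent D A z u \<in> D"
    and resolvent_right: "z *\<^sub>C resolvent D A z u - A (resolvent D A z u) = u"
    and resolvent_left: "v \<in> D \<Longrightarrow> resolvent D A z (z *\<^sub>C v - A v) = v"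
    and bounded_linear_resolvent: "bounded_linear (resolvent D A z)"
    and resolvent_scaleC: "resolvent D A z (c *\<^sub>C u) = c *\<^sub>C resolvent D A z u"
proof -
  have bij: "bij_betw (\<lambda>x. z *\<^sub>C x - A x) D UNIV" and lin: "bounded_clinear (resolvent D A z)"
    using assms by (auto simp: spectrum_def)
  show "resolvent D A z u \<in> D" "z *\<^sub>C resolvent D A z u - A (resolvent D A z u) = u"
    "v \<in> D \<Longrightarrow> resolvent D A z (z *\<^sub>C v - A v) = v"
    unfolding resolvent_def
    using bij_betwE[OF bij_betw_inv_into[OF bij]] bij_betw_inv_into_right[OF bij, of u]
      bij_betw_inv_into_left[OF bij, of v] by auto
  show "bounded_linear (resolvent D A z)" "resolvent D A z (c *\<^sub>C u) = c *\<^sub>C resolvent D A z u"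
    using lin by (simp_all add: bounded_clinear_def)
qed

lemma norm_resolvent_le: "z \<notin> spectrum D A \<Longrightarrow> norm (resolvent D A z u) \<le> onorm (resolvent D A z) * norm u"
  by (rule onorm[OF bounded_linear_resolvent])

lemma resolvent_diff:
  "z \<notin> spectrum D A \<Longrightarrow> resolvent D A z (u - v) = resolvent D A z u - resolvent D A z v"
  by (rule linear_diff[OF bounded_linear.linear[OF bounded_linear_resolvent]])

lemma resolvent_T:
  assumes "z \<notin> spectrum D A" "s \<ge> 0"
  shows "resolvent D A z (T s u) = T s (resolvent D A z u)"
proof -
  let ?v = "resolvent D A z u"
  have v: "?v \<in> D" by (rule resolvent_in_D[OF assms(1)])
  have "T s u = T s (z *\<^sub>C ?v - A ?v)"
    by (simp only: resolvent_right[OF assms(1)])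
  also have "\<dots> = z *\<^sub>C T s ?v - A (T s ?v)"
    by (simp add: T_diff T_scaleC T_D v assms)
  finally show ?thesis
    using resolvent_left[OF assms(1) T_D(1)[OF v \<open>s \<ge> 0\<close>]] by simp
qed

lemma resolvent_A:
  assumes "z \<notin> spectrum D A" "v \<in> D"
  shows "resolvent D A z (A v) = z *\<^sub>C resolvent D A z v - v"
  using resolvent_left[OF assms] by (simp add: resolvent_diff resolvent_scaleC assms(1) algebra_simps)

lemma resolvent_identity:
  assumes "z \<notin> spectrum D A" "w \<notin> spectrum D A"
  shows "(w - z) *\<^sub>C resolvent D A z (resolvent D A w u) = resolvent D A z u - resolvent D A w u"
proof -
  let ?p = "resolvent D A w u"
  have "u = w *\<^sub>C ?p - A ?p" by (simp only: resolvent_right[OF assms(2)])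
  then have "resolvent D A z u = w *\<^sub>C resolvent D A z ?p - (z *\<^sub>C resolvent D A z ?p - ?p)"
    by (metis assms resolvent_A resolvent_diff resolvent_in_D resolvent_scaleC)
  then show ?thesis by (simp add: scaleC.diff_left algebra_simps)
qed

text \<open>Solving (w - A) v = u amounts to the fixed point equation v = R(z,A) (u - (w - z) v),
  whose right side is a contraction in v by \<open>small\<close>.\<close>

lemma resolvent_set_ball:
  assumes z: "z \<notin> spectrum D A" and \<rho>: "\<And>u. norm (resolvent D A z u) \<le> \<rho> * norm u"
    and small: "cmod (w - z) * \<rho> < 1" and "\<rho> \<ge> 0"
  shows "w \<notin> spectrum D A"
proof (rule not_in_spectrumI(1)[where C="\<rho> / (1 - cmod (w - z) * \<rho>)"])
  fix u
  have "dist (resolvent D A z (u - (w - z) *\<^sub>C x)) (resolvent D A z (u - (w - z) *\<^sub>C y)) \<le>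
      cmod (w - z) * \<rho> * dist x y" for x y
  proof -
    have "resolvent D A z (u - (w - z) *\<^sub>C x) - resolvent D A z (u - (w - z) *\<^sub>C y) =
        resolvent D A z ((w - z) *\<^sub>C (y - x))"
      by (simp add: scaleC.diff_right flip: resolvent_diff[OF z])
    then show ?thesis
      using \<rho>[of "(w - z) *\<^sub>C (y - x)"] by (simp add: dist_norm norm_scaleC norm_minus_commute mult_ac)
  qed
  then obtain v where v: "resolvent D A z (u - (w - z) *\<^sub>C v) = v"
    using banach_fix_type[of "cmod (w - z) * \<rho>" "\<lambda>x. resolvent D A z (u - (w - z) *\<^sub>C x)"] small \<open>\<rho> \<ge> 0\<close> by auto
  have "z *\<^sub>C v - A v = u - (w - z) *\<^sub>C v"
    using resolvent_right[OF z, of "u - (w - z) *\<^sub>C v"] by (simp only: v)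
  then have "w *\<^sub>C v - A v = u" by (simp add: scaleC.diff_left algebra_simps)
  moreover have "v \<in> D" using resolvent_in_D[OF z] v by metis
  ultimately show "\<exists>v\<in>D. w *\<^sub>C v - A v = u" by blast
next
  fix v assume "v \<in> D"
  let ?u = "w *\<^sub>C v - A v"
  have "v = resolvent D A z (?u - (w - z) *\<^sub>C v)"
    using resolvent_left[OF z \<open>v \<in> D\<close>] by (simp add: scaleC.diff_left)
  then have "norm v \<le> \<rho> * norm (?u - (w - z) *\<^sub>C v)"
    using \<rho> by metis
  also have "\<dots> \<le> \<rho> * (norm ?u + cmod (w - z) * norm v)"
    by (intro mult_left_mono \<open>\<rho> \<ge> 0\<close>) (metis norm_scaleC norm_triangle_ineq4)
  finally show "norm v \<le> \<rho> / (1 - cmod (w - z) * \<rho>) * norm ?u"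
    using small by (simp add: field_simps)
qed

end

section \<open>Resolvent powers and positive increase\<close>

text \<open>From \<open>s0\<close> on, positive increase between \<open>u\<close> and
  \<open>r\<close>, raised to the power \<open>m\<close>, gains (r/u)^(\<alpha> m) \<ge> r/u at the
  price \<open>c ^ m\<close>. Below \<open>s0\<close>, monotonicity replaces \<open>s\<close> by
  \<open>s0\<close>, which costs the factor \<open>s0\<close>.\<close>

lemma positive_increase_power_bound:
  fixes M :: "real \<Rightarrow> real"
  assumes mono: "mono_on {1..} M" and pos: "\<And>s. s \<ge> 1 \<Longrightarrow> M s > 0"
    and inc: "\<And>l s. l \<ge> 1 \<Longrightarrow> s \<ge> s0 \<Longrightarrow> M (l * s) / M s \<ge> c * l powr \<alpha>"
    and c: "0 < c" "c \<le> 1" and s0: "s0 \<ge> 1" and m: "\<alpha> * real m \<ge> 1"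
    and s: "1 \<le> s" "s \<le> r" and r: "s0 \<le> r"
  shows "M s ^ m / s \<le> s0 / c ^ m * (M r ^ m / r)"
proof -
  have large: "M u ^ m / u \<le> (M r ^ m / r) / c ^ m" if u: "s0 \<le> u" "u \<le> r" for u
  proof -
    have "u > 0" "M u > 0" using u s0 pos[of u] by auto
    have "c * (r / u) powr \<alpha> * M u \<le> M r"
      using inc[of "r / u" u] u \<open>u > 0\<close> \<open>M u > 0\<close> by (simp add: field_simps)
    then have "(c * (r / u) powr \<alpha> * M u) ^ m \<le> M r ^ m"
      by (intro power_mono) (use c \<open>M u > 0\<close> in auto)
    moreover have "r / u \<le> ((r / u) powr \<alpha>) ^ m"
    proof -
      have "(r / u) powr 1 \<le> (r / u) powr (\<alpha> * real m)"
        by (intro powr_mono m) (use u \<open>u > 0\<close> in auto)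
      then show ?thesis
        using u \<open>u > 0\<close> by (simp add: powr_powr[symmetric] powr_realpow)
    qed
    then have "c ^ m * (r / u) * M u ^ m \<le> (c * (r / u) powr \<alpha> * M u) ^ m"
      unfolding power_mult_distrib using c \<open>M u > 0\<close> by (intro mult_right_mono mult_left_mono) auto
    ultimately have "c ^ m * (r / u) * M u ^ m \<le> M r ^ m" by linarith
    then show ?thesis using c \<open>u > 0\<close> u by (simp add: field_simps)
  qed
  have "0 \<le> M r ^ m / r / c ^ m" using pos[of r] s c by (intro divide_nonneg_nonneg) auto
  show ?thesis
  proof (cases "s0 \<le> s")
    case True
    then show ?thesis
      using large[OF True \<open>s \<le> r\<close>] mult_right_mono[OF s0 \<open>0 \<le> M r ^ m / r / c ^ m\<close>]
      by (simp add: mult_ac)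
  next
    case False
    have "M s ^ m / s \<le> M s0 ^ m / 1"
      using s False s0 pos[of s] pos[of s0] by (intro frac_le power_mono mono_onD[OF mono]) auto
    also have "\<dots> = s0 * (M s0 ^ m / s0)" using s0 by simp
    also have "\<dots> \<le> s0 * (M r ^ m / r / c ^ m)"
      using large[of s0] r s0 by (intro mult_left_mono) auto
    finally show ?thesis by (simp add: mult_ac)
  qed
qed

text \<open>The condition \<open>t \<ge> 2\<close> keeps Re z \<le> 1/2, hence |1 - z| \<ge> 1/2.
  The numerator gains near 0 and the denominator at large |Im z|; the last two bounds serve the
  terms with fewer resolvents.\<close>

lemma symbol_le:
  assumes z: "Re z = 1 / t" and t: "t \<ge> 2"
  shows "cmod (z / (1 - z)\<^sup>2) \<le> 4 * (1 / t + \<bar>Im z\<bar>)"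
    and "\<bar>Im z\<bar> \<ge> 1 \<Longrightarrow> cmod (z / (1 - z)\<^sup>2) \<le> 8 / \<bar>Im z\<bar>"
    and "cmod (z / (1 - z)\<^sup>2) \<le> 8"
    and "cmod (1 / (1 - z)) \<le> 2"
proof -
  have t': "0 < 1 / t" "1 / t \<le> 1 / 2" using t by auto
  have "1 - 1 / t \<le> cmod (1 - z)"
    using abs_Re_le_cmod[of "1 - z"] z by simp
  with t' have half: "1 / 2 \<le> cmod (1 - z)" by linarith
  have le: "cmod z \<le> 1 / t + \<bar>Im z\<bar>"
    using cmod_le[of z] z t' by simp
  have "(1 / 2)\<^sup>2 \<le> (cmod (1 - z))\<^sup>2" using half by (intro power_mono) auto
  then have "cmod z / (cmod (1 - z))\<^sup>2 \<le> cmod z / (1 / 2)\<^sup>2"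
    using half by (intro divide_left_mono mult_pos_pos zero_less_power) auto
  with le show 1: "cmod (z / (1 - z)\<^sup>2) \<le> 4 * (1 / t + \<bar>Im z\<bar>)"
    by (simp add: norm_divide norm_power power_divide)
  show 2: "cmod (z / (1 - z)\<^sup>2) \<le> 8 / \<bar>Im z\<bar>" if "\<bar>Im z\<bar> \<ge> 1"
  proof -
    have "\<bar>Im z\<bar>\<^sup>2 \<le> (cmod (1 - z))\<^sup>2"
      using abs_Im_le_cmod[of "1 - z"] by (intro power_mono) auto
    moreover have "cmod z \<le> 8 * \<bar>Im z\<bar>" using le t' that by linarith
    ultimately have le8: "cmod z / (cmod (1 - z))\<^sup>2 \<le> (8 * \<bar>Im z\<bar>) / \<bar>Im z\<bar>\<^sup>2"
      using that by (intro frac_le) auto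
    have "8 * x / x\<^sup>2 = 8 / x" for x :: real by (simp add: power2_eq_square)
    with le8 have "cmod z / (cmod (1 - z))\<^sup>2 \<le> 8 / \<bar>Im z\<bar>" by (simp only:)
    then show ?thesis by (simp only: norm_divide norm_power)
  qed
  show "cmod (z / (1 - z)\<^sup>2) \<le> 8"
  proof (cases "\<bar>Im z\<bar> \<ge> 1")
    case True
    have "8 / \<bar>Im z\<bar> \<le> 8 / 1" using True by (intro divide_left_mono) auto
    with 2[OF True] show ?thesis by simp
  next
    case False
    then have "4 * (1 / t + \<bar>Im z\<bar>) \<le> 4 * (1 / 2 + 1)"
      using t' by (intro mult_left_mono add_mono) auto
    with 1 show ?thesis by simp
  qed
  show "cmod (1 / (1 - z)) \<le> 2"
    using frac_le[of 1 1 "1 / 2" "cmod (1 - z)"] half by (simp add: norm_divide)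
qed

lemma norm_funpow_le:
  fixes L :: "'a::real_normed_vector \<Rightarrow> 'a"
  assumes "\<And>u. norm (L u) \<le> \<rho> * norm u" "\<rho> \<ge> 0"
  shows "norm ((L ^^ m) u) \<le> \<rho> ^ m * norm u"
proof (induction m)
  case (Suc m)
  have "norm ((L ^^ Suc m) u) \<le> \<rho> * norm ((L ^^ m) u)" using assms(1) by simp
  also have "\<dots> \<le> \<rho> * (\<rho> ^ m * norm u)" by (intro mult_left_mono Suc assms)
  finally show ?case by (simp add: mult_ac)
qed simp

context bounded_C0_semigroup
begin

text \<open>Apply the resolvent identity to z and its projection to the axis. Their distance
  \<open>Re z\<close> cancels against the half-plane bound \<open>K / Re z\<close>, so bounds on the
  axis carry over to every line to its right with the loss 1 + K.\<close>

lemma norm_resolvent_near_axis: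
  assumes "Re z > 0" and w: "\<i> * complex_of_real (Im z) \<notin> spectrum D A"
    and \<rho>: "onorm (resolvent D A (\<i> * complex_of_real (Im z))) \<le> \<rho>"
  shows "norm (resolvent D A z u) \<le> (1 + K) * \<rho> * norm u"
proof -
  define w where "w = \<i> * complex_of_real (Im z)"
  note z = right_half_plane[OF \<open>Re z > 0\<close>]
  have R_w: "norm (resolvent D A w u) \<le> \<rho> * norm u"
    using norm_resolvent_le[OF w, of u] mult_right_mono[OF \<rho> norm_ge_zero[of u]] by (simp add: w_def)
  have "w - z = - complex_of_real (Re z)"
    by (simp add: w_def complex_eq_iff)
  then have "cmod (w - z) = Re z" using \<open>Re z > 0\<close> by simp
  have "resolvent D A z u = (w - z) *\<^sub>C resolvent D A z (resolvent D A w u) + resolvent D A w u"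
    using resolvent_identity[OF z(1) w] by (simp add: w_def)
  then have "norm (resolvent D A z u) \<le>
      norm ((w - z) *\<^sub>C resolvent D A z (resolvent D A w u)) + norm (resolvent D A w u)"
    by (metis norm_triangle_ineq)
  also have "norm ((w - z) *\<^sub>C resolvent D A z (resolvent D A w u)) \<le> Re z * (K / Re z * norm (resolvent D A w u))"
    unfolding norm_scaleC \<open>cmod (w - z) = Re z\<close> using \<open>Re z > 0\<close> by (intro mult_left_mono z) auto
  also have "\<dots> = K * norm (resolvent D A w u)" using \<open>Re z > 0\<close> by simp
  finally have "norm (resolvent D A z u) \<le> (1 + K) * norm (resolvent D A w u)"
    by (simp add: algebra_simps)
  also have "\<dots> \<le> (1 + K) * (\<rho> * norm u)"
    by (intro mult_left_mono R_w) (use K_ge_1 in auto)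
  finally show ?thesis by (simp add: mult_ac)
qed

text \<open>The factor \<open>z / (1 - z)\<^sup>2\<close> is what \<open>A R(1,A)\<^sup>2\<close> contributes at frequency \<open>z\<close>. Outside
  \<open>1 / r \<le> \<bar>Im z\<bar> \<le> r\<close> it is itself at most \<open>8 / r\<close>; inside, the power \<open>m\<close> of the resolvent turns
  positive increase into linear growth.\<close>

lemma symbol_resolvent_power_le:
  assumes spec: "\<And>\<eta>. \<eta> \<noteq> 0 \<Longrightarrow> \<i> * complex_of_real \<eta> \<notin> spectrum D A"
    and low: "\<And>s::real. \<bar>s\<bar> \<ge> 1 \<Longrightarrow> onorm (resolvent D A (\<i> * complex_of_real (inverse s))) \<le> M \<bar>s\<bar>"
    and high: "\<And>s::real. \<bar>s\<bar> \<ge> 1 \<Longrightarrow> onorm (resolvent D A (\<i> * complex_of_real s)) \<le> M \<bar>s\<bar>"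
    and mono: "mono_on {1..} M" and pos: "\<And>s. s \<ge> 1 \<Longrightarrow> M s > 0"
    and inc: "\<And>l s. l \<ge> 1 \<Longrightarrow> s \<ge> s0 \<Longrightarrow> M (l * s) / M s \<ge> c * l powr \<alpha>"
    and c: "0 < c" "c \<le> 1" and s0: "s0 \<ge> 1" and m: "\<alpha> * real m \<ge> 1"
    and t: "t \<ge> 2" and r: "s0 \<le> r" "r \<le> t" "M r \<le> t" and z: "Re z = 1 / t"
  shows "cmod (z / (1 - z)\<^sup>2) * norm ((resolvent D A z ^^ m) u) \<le>
    8 * (1 + K) ^ m * (s0 / c ^ m) * (t ^ m / r) * norm u"
proof -
  let ?R = "resolvent D A z" and ?q = "cmod (z / (1 - z)\<^sup>2)" and ?C = "8 * (1 + K) ^ m * (s0 / c ^ m) * (t ^ m / r)"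
  have "Re z > 0" "r \<ge> 1" "r > 0" using z t r s0 by auto
  have c1: "1 \<le> s0 / c ^ m"
    using s0 c power_le_one[of c m] by (simp add: field_simps)
  have reduce: "?q * norm ((?R ^^ m) u) \<le> ?C * norm u"
    if "\<And>u. norm (?R u) \<le> \<rho> * norm u" "\<rho> \<ge> 0" "?q * \<rho> ^ m \<le> ?C" for \<rho>
  proof -
    have "?q * norm ((?R ^^ m) u) \<le> ?q * (\<rho> ^ m * norm u)"
      by (intro mult_left_mono norm_funpow_le that) auto
    also have "\<dots> \<le> ?C * norm u"
      using mult_right_mono[OF that(3) norm_ge_zero[of u]] by (simp add: mult_ac)
    finally show ?thesis .
  qed
  have crude: "norm (?R u) \<le> (K * t) * norm u" for u
    using right_half_plane(2)[OF \<open>Re z > 0\<close>, of u] z by simp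
  \<comment> \<open>Only the half-plane bound \<open>K / Re z = K * t\<close> enters here, so this
    case may contain frequency 0, where nothing is known on the axis.\<close>
  have outer: ?thesis if "?q \<le> 8 / r"
  proof (rule reduce[OF crude])
    show "0 \<le> K * t" using K_ge_1 t by simp
    have "?q * (K * t) ^ m \<le> (8 / r) * (K * t) ^ m"
      using that K_ge_1 t by (intro mult_right_mono) auto
    also have "\<dots> = 8 * K ^ m * 1 * (t ^ m / r)" by (simp add: power_mult_distrib)
    also have "\<dots> \<le> ?C"
    proof (rule mult_right_mono)
      have "K ^ m \<le> (1 + K) ^ m" using K_ge_1 by (intro power_mono) auto
      then show "8 * K ^ m * 1 \<le> 8 * (1 + K) ^ m * (s0 / c ^ m)"
        using K_ge_1 by (intro mult_mono[OF _ c1]) auto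
    qed (use t \<open>r > 0\<close> in simp)
    finally show "?q * (K * t) ^ m \<le> ?C" .
  qed
  \<comment> \<open>The parameter \<open>s\<close> will be |Im z| at high frequencies and its
    inverse at low ones; both give the same pair of bounds.\<close>
  have inner: ?thesis if s: "1 \<le> s" "s \<le> r" and q: "?q \<le> 8 / s"
    and R: "onorm (resolvent D A (\<i> * complex_of_real (Im z))) \<le> M s" and "Im z \<noteq> 0" for s
  proof (rule reduce)
    show "norm (?R u) \<le> ((1 + K) * M s) * norm u" for u
      by (rule norm_resolvent_near_axis[OF \<open>Re z > 0\<close> spec[OF \<open>Im z \<noteq> 0\<close>] R])
    show "0 \<le> (1 + K) * M s" using K_ge_1 pos[of s] s by simp
    have "?q * ((1 + K) * M s) ^ m \<le> (8 / s) * ((1 + K) * M s) ^ m"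
      using q K_ge_1 pos[of s] s by (intro mult_right_mono) auto
    also have "\<dots> = 8 * (1 + K) ^ m * (M s ^ m / s)" by (simp add: power_mult_distrib)
    also have "\<dots> \<le> 8 * (1 + K) ^ m * (s0 / c ^ m * (M r ^ m / r))"
      using K_ge_1 by (intro mult_left_mono positive_increase_power_bound[OF mono pos inc c s0 m s r(1)]) auto
    also have "\<dots> \<le> 8 * (1 + K) ^ m * (s0 / c ^ m * (t ^ m / r))"
      using K_ge_1 r pos[of r] \<open>r \<ge> 1\<close> c s0 by (intro mult_left_mono divide_right_mono power_mono) auto
    finally show "?q * ((1 + K) * M s) ^ m \<le> ?C" by (simp add: mult_ac)
  qed
  consider "r \<le> \<bar>Im z\<bar>" | "1 \<le> \<bar>Im z\<bar>" "\<bar>Im z\<bar> \<le> r" | "1 / r \<le> \<bar>Im z\<bar>" "\<bar>Im z\<bar> \<le> 1" | "\<bar>Im z\<bar> \<le> 1 / r"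
    by linarith
  then show ?thesis
  proof cases
    case 1
    have "8 / \<bar>Im z\<bar> \<le> 8 / r" using 1 \<open>r > 0\<close> by (intro divide_left_mono) auto
    then show ?thesis using outer symbol_le(2)[OF z t] 1 \<open>r \<ge> 1\<close> by linarith
  next
    case 2
    then show ?thesis
      by (intro inner[of "\<bar>Im z\<bar>"] high symbol_le(2)[OF z t]) auto
  next
    case 3
    have "Im z \<noteq> 0" using 3 \<open>r > 0\<close> by auto
    \<comment> \<open>Since r \<le> t, the real part 1/t of z is at most |Im z| here and is
      absorbed, which doubles the factor 4.\<close>
    have "1 / t \<le> 1 / r" using r \<open>r > 0\<close> by (intro divide_left_mono) auto
    with 3 have "1 / t \<le> \<bar>Im z\<bar>" by (meson order_trans)
    then have "4 * (1 / t + \<bar>Im z\<bar>) \<le> 4 * (\<bar>Im z\<bar> + \<bar>Im z\<bar>)"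
      by (intro mult_left_mono add_right_mono) auto
    with symbol_le(1)[OF z t] have "?q \<le> 8 * \<bar>Im z\<bar>" by simp
    then have "?q \<le> 8 / inverse \<bar>Im z\<bar>" by (simp add: divide_inverse)
    moreover have one_le: "1 \<le> inverse \<bar>Im z\<bar>"
      using 3 \<open>Im z \<noteq> 0\<close> by (intro one_le_inverse) auto
    moreover have "inverse \<bar>Im z\<bar> \<le> r"
      using le_imp_inverse_le[of "inverse r" "\<bar>Im z\<bar>"] 3 \<open>r > 0\<close> by (simp add: divide_inverse)
    moreover have "onorm (resolvent D A (\<i> * complex_of_real (Im z))) \<le> M (inverse \<bar>Im z\<bar>)"
      using low[of "inverse (Im z)"] one_le by (simp add: abs_inverse)
    ultimately show ?thesis using \<open>Im z \<noteq> 0\<close> by (intro inner)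
  next
    case 4
    have "1 / t \<le> 1 / r" using r \<open>r > 0\<close> by (intro divide_left_mono) auto
    with 4 have "4 * (1 / t + \<bar>Im z\<bar>) \<le> 4 * (1 / r + 1 / r)"
      by (intro mult_left_mono add_mono) auto
    also have "4 * (1 / r + 1 / r) = 8 / r" by simp
    finally have "?q \<le> 8 / r" by (rule order_trans[OF symbol_le(1)[OF z t]])
    then show ?thesis by (rule outer)
  qed
qed

text \<open>Otherwise the disc of \<open>resolvent_set_ball\<close> around \<open>z\<close> would
  contain 0. At z = i/s this yields \<open>M s \<ge> s\<close> in the theorem.\<close>

lemma onorm_resolvent_ge_inverse:
  assumes "0 \<in> spectrum D A" "z \<notin> spectrum D A"
  shows "1 \<le> cmod z * onorm (resolvent D A z)"
proof (rule ccontr)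
  assume "\<not> ?thesis"
  then have "0 \<notin> spectrum D A"
    using assms(2) onorm_pos_le[OF bounded_linear_resolvent[OF assms(2)]]
    by (intro resolvent_set_ball[of z "onorm (resolvent D A z)" 0] norm_resolvent_le) auto
  then show False using assms(1) by simp
qed

end

section \<open>Fourier coefficients of orbits\<close>

text \<open>Zeros of order m at 0 and 1 are encoded as divisibility by
  \<open>[:0, 1, -1:] ^ m\<close>, that is (s - s^2)^m. Each derivative lowers the exponent by one,
  so all m integrations by parts are free of boundary terms.\<close>

lemma pderiv_dvd_power:
  fixes p q :: "'a::idom poly"
  assumes "q ^ Suc m dvd p"
  shows "q ^ m dvd pderiv p"
proof -
  obtain u where "p = q ^ Suc m * u" using assms by (rule dvdE)
  then have "pderiv p = q ^ m * (q * pderiv u + smult (of_nat (Suc m)) (pderiv q) * u)"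
    unfolding \<open>p = _\<close> pderiv_mult pderiv_power_Suc by (simp add: algebra_simps)
  then show ?thesis by simp
qed

lemma square_add3_le: "(a + b + c)\<^sup>2 \<le> 3 * (a\<^sup>2 + b\<^sup>2 + c\<^sup>2)" for a b c :: real
proof -
  have "0 \<le> (a - b)\<^sup>2 + (b - c)\<^sup>2 + (a - c)\<^sup>2" by simp
  then show ?thesis by (simp add: power2_eq_square algebra_simps)
qed

context bounded_C0_semigroup
begin

text \<open>With exp(-s) built in, the k-th coefficient integrates exp(-(1 + 2 pi i k) s) T(t s), so
  that the relevant z lies in the right half-plane for every k.\<close>

definition orbit_profile :: "(real \<Rightarrow> real) \<Rightarrow> real \<Rightarrow> 'a \<Rightarrow> real \<Rightarrow> 'a"
  where "orbit_profile f t y s = (f s * exp (- s)) *\<^sub>R T (t * s) y"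

lemma continuous_on_orbit_profile:
  assumes "t \<ge> 0" "continuous_on {0..1} f"
  shows "continuous_on {0..1} (orbit_profile f t y)"
  unfolding orbit_profile_def using assms by (intro continuous_intros) auto

lemma fourier_coeff_linear:
  assumes "t \<ge> 0" "continuous_on {0..1} f" and L: "bounded_linear L"
    and T: "\<And>s u. s \<ge> 0 \<Longrightarrow> L (T s u) = T s (L u)" and C: "\<And>c u. L (c *\<^sub>C u) = c *\<^sub>C L u"
  shows "fourier_coeff (orbit_profile f t (L y)) k = L (fourier_coeff (orbit_profile f t y) k)"
proof -
  have "(\<lambda>s. unit_exp (- k) s *\<^sub>C orbit_profile f t y s) integrable_on {0..1}"
    by (intro integrable_continuous_real continuous_intros continuous_on_orbit_profile assms)
  from integral_linear[OF this L]
  have "L (fourier_coeff (orbit_profile f t y) k) =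
      integral {0..1} (\<lambda>s. L (unit_exp (- k) s *\<^sub>C orbit_profile f t y s))"
    by (simp add: fourier_coeff_def o_def)
  also have "\<dots> = fourier_coeff (orbit_profile f t (L y)) k"
    unfolding fourier_coeff_def orbit_profile_def
    by (rule integral_cong) (use \<open>t \<ge> 0\<close> in \<open>simp add: C T scaleR_scaleC\<close>)
  finally show ?thesis by simp
qed

lemma fourier_coeff_diff:
  assumes "t \<ge> 0" "continuous_on {0..1} f"
  shows "fourier_coeff (orbit_profile f t (u - v)) k =
    fourier_coeff (orbit_profile f t u) k - fourier_coeff (orbit_profile f t v) k"
proof -
  have int: "(\<lambda>s. unit_exp (- k) s *\<^sub>C orbit_profile f t y s) integrable_on {0..1}" for y
    by (intro integrable_continuous_real continuous_intros continuous_on_orbit_profile assms)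
  show ?thesis
    unfolding fourier_coeff_def integral_diff[OF int int, symmetric]
    by (rule integral_cong)
       (use \<open>t \<ge> 0\<close> in \<open>simp add: orbit_profile_def T_diff scaleR_diff_right scaleC.diff_right\<close>)
qed

lemma fourier_coeff_scaleC:
  assumes "t \<ge> 0" "continuous_on {0..1} f"
  shows "fourier_coeff (orbit_profile f t (c *\<^sub>C u)) k = c *\<^sub>C fourier_coeff (orbit_profile f t u) k"
  by (rule fourier_coeff_linear[OF assms scaleC.bounded_linear_right])
     (simp_all add: T_scaleC scaleC_scaleC mult.commute)

lemma fourier_coeff_resolvent_power:
  assumes "t \<ge> 0" "continuous_on {0..1} f" "z \<notin> spectrum D A"
  shows "fourier_coeff (orbit_profile f t ((resolvent D A z ^^ m) u)) k =
    (resolvent D A z ^^ m) (fourier_coeff (orbit_profile f t u) k)"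
  by (induction m)
     (simp_all add: fourier_coeff_linear assms resolvent_T resolvent_scaleC bounded_linear_resolvent)

text \<open>Integration by parts, using that \<open>exp (- w s) T (t s)\<close> has generator \<open>t A - w = t (A - z)\<close>
  for \<open>w = 1 + 2 \<pi> \<i> k\<close> and \<open>z = w / t\<close>.\<close>

lemma fourier_coeff_by_parts:
  assumes "t > 0" and p: "poly p 0 = 0" "poly p 1 = 0"
    and z: "z = Complex (1 / t) (2 * pi * real_of_int k / t)"
  shows "fourier_coeff (orbit_profile (poly p) t y) k =
    (1 / t) *\<^sub>R fourier_coeff (orbit_profile (poly (pderiv p)) t (resolvent D A z y)) k"
proof -
  define w where "w = Complex 1 (2 * pi * real_of_int k)"
  define S where "S s x = exp (- (w * complex_of_real s)) *\<^sub>C T (t * s) x" for s x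
  have "Re z > 0" using \<open>t > 0\<close> z by simp
  note zs = right_half_plane(1)[OF this]
  interpret S: bounded_C0_semigroup S D "\<lambda>x. t *\<^sub>R A x - w *\<^sub>C x" K
    unfolding S_def[abs_def] by (rule rescale) (use \<open>t > 0\<close> in \<open>simp_all add: w_def\<close>)
  have w_eq: "w = complex_of_real t * z"
    using \<open>t > 0\<close> by (simp add: w_def z complex_eq_iff)
  have S_eq: "unit_exp (- k) s *\<^sub>C orbit_profile f t x s = f s *\<^sub>R S s x" for f s x
  proof -
    have "exp (- (w * complex_of_real s)) = unit_exp (- k) s * complex_of_real (exp (- s))"
    proof -
      have "- (w * complex_of_real s) =
          \<i> * complex_of_real (2 * pi * (real_of_int (- k) * s)) + complex_of_real (- s)"
        by (simp add: w_def complex_eq_iff)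
      then show ?thesis
        by (simp only: unit_exp_def cis_conv_exp exp_add exp_of_real)
    qed
    then show ?thesis
      by (simp add: S_def orbit_profile_def scaleR_scaleC scaleC_scaleC mult_ac)
  qed
  \<comment> \<open>Chosen so that t A - w, the generator of \<open>S\<close>, maps \<open>v\<close>
    to -t y: the derivative of \<open>S s v\<close> is a multiple of \<open>S s y\<close>, and the
    resolvent appears in the other term of the product rule.\<close>
  define v where "v = resolvent D A z y"
  have v: "v \<in> D" "z *\<^sub>C v - A v = y"
    unfolding v_def by (simp_all add: resolvent_in_D resolvent_right zs)
  have "t *\<^sub>R A v - w *\<^sub>C v = - (t *\<^sub>R y)"
    by (simp add: w_eq scaleR_scaleC scaleC_scaleC[symmetric] scaleC.diff_right flip: v(2))
  then have dS: "((\<lambda>s. S s v) has_vector_derivative - (t *\<^sub>R S s y)) (at s within {0..1})" if "s \<in> {0..1}" for s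
    using S.T_has_vector_derivative[OF v(1) that] that
    by (simp add: S.T_scaleR linear_neg[OF bounded_linear.linear[OF S.bounded_linear_T]])
  have "((\<lambda>s. poly p s *\<^sub>R S s v) has_vector_derivative
      (poly p s *\<^sub>R (- (t *\<^sub>R S s y)) + poly (pderiv p) s *\<^sub>R S s v)) (at s within {0..1})" if "s \<in> {0..1}" for s
    by (rule has_vector_derivative_scaleR[OF has_field_derivative_at_within[OF poly_DERIV] dS[OF that]])
  then have "((\<lambda>s. poly p s *\<^sub>R (- (t *\<^sub>R S s y)) + poly (pderiv p) s *\<^sub>R S s v) has_integral
      (poly p 1 *\<^sub>R S 1 v - poly p 0 *\<^sub>R S 0 v)) {0..1}"
    by (intro fundamental_theorem_of_calculus) auto
  then have zero: "integral {0..1} (\<lambda>s. poly (pderiv p) s *\<^sub>R S s v - t *\<^sub>R (poly p s *\<^sub>R S s y)) = 0"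
    by (simp add: p integral_unique mult.commute)
  have int: "(\<lambda>s. poly p s *\<^sub>R S s x) integrable_on {0..1}" for p x
    by (intro integrable_continuous_real continuous_intros S.continuous_on_T') auto
  have "integral {0..1} (\<lambda>s. poly (pderiv p) s *\<^sub>R S s v) = t *\<^sub>R integral {0..1} (\<lambda>s. poly p s *\<^sub>R S s y)"
    using zero integral_diff[OF int[of "pderiv p" v] integrable_cmul[OF int[of p y], of t]]
    by (simp del: scaleR_scaleR)
  then show ?thesis
    using \<open>t > 0\<close> by (simp add: fourier_coeff_def S_eq v_def)
qed

lemma fourier_coeff_by_parts_iterated:
  assumes "t > 0" and z: "z = Complex (1 / t) (2 * pi * real_of_int k / t)"
  shows "[:0, 1, -1:] ^ m dvd p \<Longrightarrow> fourier_coeff (orbit_profile (poly p) t y) k =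
    (1 / t ^ m) *\<^sub>R fourier_coeff (orbit_profile (poly ((pderiv ^^ m) p)) t ((resolvent D A z ^^ m) y)) k"
proof (induction m arbitrary: p y)
  case (Suc m)
  have "[:0, 1, -1:] dvd p" by (rule dvd_trans[OF dvd_power Suc.prems]) simp
  then have "poly p 0 = 0" "poly p 1 = 0" by auto
  from fourier_coeff_by_parts[OF \<open>t > 0\<close> this z] Suc.IH[OF pderiv_dvd_power[OF Suc.prems]]
  show ?case by (simp add: funpow_swap1)
qed simp

text \<open>The resolvent identity between z and 1, used twice. Only one term keeps a resolvent at
  z, and it carries the scalar factor that \<open>symbol_resolvent_power_le\<close>
  controls.\<close>

lemma A_resolvent_resolvent_symbol:
  assumes z: "z \<notin> spectrum D A" and one: "1 \<notin> spectrum D A" and "z \<noteq> 1"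
  defines "R \<equiv> resolvent D A 1"
  shows "resolvent D A z (A (R (R x))) =
    (z / (1 - z)\<^sup>2) *\<^sub>C (resolvent D A z x - R x) - (1 / (1 - z)) *\<^sub>C R (R x)"
proof -
  have step: "resolvent D A z (R u) = (1 / (1 - z)) *\<^sub>C (resolvent D A z u - R u)" for u
  proof -
    have "(1 / (1 - z)) *\<^sub>C ((1 - z) *\<^sub>C resolvent D A z (R u)) = resolvent D A z (R u)"
      using \<open>z \<noteq> 1\<close> by (simp add: scaleC_scaleC scaleC_one)
    then show ?thesis by (simp add: resolvent_identity z one R_def)
  qed
  define a where "a = 1 / (1 - z)"
  \<comment> \<open>This cancels one copy of \<open>R (R x)\<close> below and leaves it with the
    coefficient \<open>- a\<close>.\<close>
  have a: "z * a = a - 1" using \<open>z \<noteq> 1\<close> by (simp add: a_def field_simps)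
  have "R (R x) \<in> D" unfolding R_def by (rule resolvent_in_D[OF one])
  then have "resolvent D A z (A (R (R x))) = z *\<^sub>C resolvent D A z (R (R x)) - R (R x)"
    by (rule resolvent_A[OF z])
  also have "\<dots> = z *\<^sub>C a *\<^sub>C (a *\<^sub>C (resolvent D A z x - R x) - R (R x)) - R (R x)"
    by (simp only: step a_def)
  also have "\<dots> = (z * a * a) *\<^sub>C (resolvent D A z x - R x) - (z * a) *\<^sub>C R (R x) - R (R x)"
    by (simp add: scaleC.diff_right scaleC_scaleC mult.assoc)
  also have "(z * a) *\<^sub>C R (R x) = a *\<^sub>C R (R x) - R (R x)"
    by (simp add: a scaleC.diff_left scaleC_one)
  also have "z * a * a = z / (1 - z)\<^sup>2" by (simp add: a_def power2_eq_square)
  finally show ?thesis by (simp add: a_def)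
qed

lemma integral_norm_orbit_profile_le:
  assumes "t \<ge> 0" "continuous_on {0..1} f" and B: "\<And>s. s \<in> {0..1} \<Longrightarrow> \<bar>f s\<bar> \<le> B"
  shows "integral {0..1} (\<lambda>s. (norm (orbit_profile f t y s))\<^sup>2) \<le> (B * K * norm y)\<^sup>2"
proof -
  have "integral {0..1} (\<lambda>s. (norm (orbit_profile f t y s))\<^sup>2) \<le> integral {0..1} (\<lambda>s::real. (B * K * norm y)\<^sup>2)"
  proof (rule integral_le)
    fix s :: real assume s: "s \<in> {0..1}"
    have "norm (orbit_profile f t y s) = \<bar>f s\<bar> * exp (- s) * norm (T (t * s) y)"
      by (simp add: orbit_profile_def abs_mult)
    also have "\<dots> \<le> (B * 1) * (K * norm y)"
      using s \<open>t \<ge> 0\<close> order_trans[OF abs_ge_zero B[OF s]] by (intro mult_mono B norm_T) auto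
    finally show "(norm (orbit_profile f t y s))\<^sup>2 \<le> (B * K * norm y)\<^sup>2"
      by (intro power_mono) (simp_all add: mult_ac)
  qed (intro integrable_continuous_real continuous_intros continuous_on_orbit_profile assms)+
  then show ?thesis by simp
qed

text \<open>\<open>L\<close> may depend on \<open>t\<close>, \<open>y\<close> and \<open>p\<close>,
  because \<open>parseval_lower_bound\<close> yields a bound without it. Taking w = 1 in
  \<open>rescale\<close> makes the damping exp(-s) part of the semigroup \<open>S\<close>.\<close>

lemma orbit_profile_lipschitz:
  assumes "t > 0" "y \<in> D"
  obtains L where "L \<ge> 0"
    "\<And>s r. s \<in> {0..1} \<Longrightarrow> r \<in> {0..1} \<Longrightarrow>
      norm (orbit_profile (poly p) t y s - orbit_profile (poly p) t y r) \<le> L * \<bar>s - r\<bar>"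
proof -
  define S where "S s x = exp (- (1 * complex_of_real s)) *\<^sub>C T (t * s) x" for s x
  interpret S: bounded_C0_semigroup S D "\<lambda>x. t *\<^sub>R A x - 1 *\<^sub>C x" K
    unfolding S_def[abs_def] by (rule rescale) (use \<open>t > 0\<close> in simp_all)
  define g' where "g' s = poly p s *\<^sub>R S s (t *\<^sub>R A y - 1 *\<^sub>C y) + poly (pderiv p) s *\<^sub>R S s y" for s
  have prof: "orbit_profile (poly p) t y s = poly p s *\<^sub>R S s y" for s
    by (simp add: orbit_profile_def S_def scaleR_scaleC scaleC_scaleC exp_of_real[symmetric])
  have deriv: "(orbit_profile (poly p) t y has_vector_derivative g' s) (at s within {0..1})" if "s \<in> {0..1}" for s
    unfolding prof[abs_def] g'_def
    by (rule has_vector_derivative_scaleR[OF has_field_derivative_at_within[OF poly_DERIV]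
          S.T_has_vector_derivative[OF \<open>y \<in> D\<close> that]])
  have "continuous_on {0..1} g'"
    unfolding g'_def by (intro continuous_intros S.continuous_on_T') auto
  then have "bounded (g' ` {0..1})"
    by (intro compact_imp_bounded compact_continuous_image) simp_all
  then obtain L where "L > 0" "\<forall>x\<in>g' ` {0..1}. norm x \<le> L"
    unfolding bounded_pos by blast
  then have L: "norm (g' s) \<le> L" if "s \<in> {0..1}" for s using that by blast
  have "norm (orbit_profile (poly p) t y s - orbit_profile (poly p) t y r) \<le> L * norm (s - r)"
    if "s \<in> {0..1}" "r \<in> {0..1}" for s r
  proof (rule differentiable_bound[of "{0..1}" _ "\<lambda>s h. h *\<^sub>R g' s"])
    show "onorm (\<lambda>h. h *\<^sub>R g' s) \<le> L" if "s \<in> {0..1}" for s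
    proof (rule onorm_bound)
      show "norm (h *\<^sub>R g' s) \<le> L * norm h" for h
        using mult_right_mono[OF L[OF that] norm_ge_zero[of h]] by (simp add: mult.commute)
    qed (use \<open>L > 0\<close> in simp)
  qed (use deriv that in \<open>auto simp: has_vector_derivative_def\<close>)
  then show ?thesis using that[of L] \<open>L > 0\<close> by simp
qed

text \<open>Writing T(t) y = T(t - t s) T(t s) y bounds its norm by \<open>K\<close> times every
  earlier orbit value; undoing the damping on [0,1] costs at most \<open>exp 1\<close>. Then average
  with weight f^2.\<close>

lemma norm_T_le_integral:
  assumes "t \<ge> 0" "continuous_on {0..1} f"
  shows "integral {0..1} (\<lambda>s. (f s)\<^sup>2) * (norm (T t y))\<^sup>2 \<le>
    (K * exp 1)\<^sup>2 * integral {0..1} (\<lambda>s. (norm (orbit_profile f t y s))\<^sup>2)"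
proof -
  have "integral {0..1} (\<lambda>s. (f s)\<^sup>2 * (norm (T t y))\<^sup>2) \<le>
      integral {0..1} (\<lambda>s. (K * exp 1)\<^sup>2 * (norm (orbit_profile f t y s))\<^sup>2)"
  proof (rule integral_le)
    fix s :: real assume s: "s \<in> {0..1}"
    have "t * s \<le> t" using mult_left_le[of s t] s \<open>t \<ge> 0\<close> by simp
    then have "T t y = T (t - t * s) (T (t * s) y)"
      using T_add[of "t - t * s" "t * s" y] s \<open>t \<ge> 0\<close> by simp
    then have "norm (T t y) \<le> K * norm (T (t * s) y)"
      using norm_T[of "t - t * s" "T (t * s) y"] \<open>t * s \<le> t\<close> by simp
    also have "\<dots> \<le> K * (exp 1 * exp (- s) * norm (T (t * s) y))"
    proof (rule mult_left_mono)
      have "1 \<le> exp 1 * exp (- s)" using s by (simp flip: exp_add)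
      from mult_right_mono[OF this norm_ge_zero]
      show "norm (T (t * s) y) \<le> exp 1 * exp (- s) * norm (T (t * s) y)" by simp
    qed (use K_ge_1 in simp)
    finally have "\<bar>f s\<bar> * norm (T t y) \<le> K * exp 1 * norm (orbit_profile f t y s)"
      using mult_left_mono[of "norm (T t y)" "K * (exp 1 * exp (- s) * norm (T (t * s) y))" "\<bar>f s\<bar>"]
      by (simp add: orbit_profile_def abs_mult mult_ac)
    then have "(\<bar>f s\<bar> * norm (T t y))\<^sup>2 \<le> (K * exp 1 * norm (orbit_profile f t y s))\<^sup>2"
      by (intro power_mono) auto
    then show "(f s)\<^sup>2 * (norm (T t y))\<^sup>2 \<le> (K * exp 1)\<^sup>2 * (norm (orbit_profile f t y s))\<^sup>2"
      by (simp add: power_mult_distrib)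
  qed (intro integrable_continuous_real continuous_intros continuous_on_orbit_profile assms)+
  then show ?thesis by simp
qed

lemma resolvent_power_diff:
  "z \<notin> spectrum D A \<Longrightarrow> (resolvent D A z ^^ n) (u - v) = (resolvent D A z ^^ n) u - (resolvent D A z ^^ n) v"
  by (induction n) (simp_all add: resolvent_diff)

lemma resolvent_power_scaleC:
  "z \<notin> spectrum D A \<Longrightarrow> (resolvent D A z ^^ n) (c *\<^sub>C u) = c *\<^sub>C (resolvent D A z ^^ n) u"
  by (induction n) (simp_all add: resolvent_scaleC)

lemma norm_resolvent_1_le: "norm (resolvent D A 1 u) \<le> K * norm u"
  using right_half_plane(2)[of 1 u] by simp

text \<open>One of the \<open>Suc n\<close> resolvents is spent on
  \<open>A_resolvent_resolvent_symbol\<close>. Taking coefficients commutes with resolvents, so the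
  operator bounds act on the coefficients of the orbits of \<open>x\<close>, \<open>R x\<close> and
  \<open>R (R x)\<close>, to which Bessel's inequality can be applied.\<close>

lemma norm_fourier_coeff_le:
  fixes x :: 'a and f :: "real \<Rightarrow> real"
  defines "R \<equiv> resolvent D A 1"
  assumes t: "t \<ge> 2" "1 \<le> r" "r \<le> t" and z: "z = Complex (1 / t) (2 * pi * real_of_int k / t)"
    and symbol: "\<And>u. cmod (z / (1 - z)\<^sup>2) * norm ((resolvent D A z ^^ Suc n) u) \<le> Q * (t ^ Suc n / r) * norm u"
    and "Q \<ge> 0" and p: "[:0, 1, -1:] ^ Suc n dvd p" and f: "f = poly ((pderiv ^^ Suc n) p)"
  shows "norm (fourier_coeff (orbit_profile (poly p) t (A (R (R x)))) k) \<le> (Q + 8 * K ^ Suc n) / r *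
    (norm (fourier_coeff (orbit_profile f t x) k) + norm (fourier_coeff (orbit_profile f t (R x)) k) +
     norm (fourier_coeff (orbit_profile f t (R (R x))) k))"
proof -
  define X where "X u = fourier_coeff (orbit_profile f t u) k" for u
  define q b where "q = z / (1 - z)\<^sup>2" and "b = 1 / (1 - z)"
  let ?Rz = "resolvent D A z"
  have t0: "t > 0" "t \<ge> 0" and Re_z: "Re z = 1 / t" "Re z > 0" and "z \<noteq> 1"
    using t by (auto simp: z complex_eq_iff)
  have zs: "z \<notin> spectrum D A" "1 \<notin> spectrum D A"
    using right_half_plane(1) Re_z by auto
  have f_cont: "continuous_on {0..1} f"
    unfolding f by (intro continuous_intros)
  have q8: "cmod q \<le> 8" and b2: "cmod b \<le> 8"
    using symbol_le(3,4)[OF Re_z(1) t(1)] by (simp_all add: q_def b_def)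
  \<comment> \<open>The terms with one resolvent fewer need no cancellation from the scalar factor:
    \<open>t ^ n \<le> t ^ Suc n / r\<close> because \<open>r \<le> t\<close>.\<close>
  have crude: "norm ((?Rz ^^ n) u) \<le> K ^ Suc n * (t ^ Suc n / r) * norm u" for u
  proof -
    have "norm ((?Rz ^^ n) u) \<le> (K * t) ^ n * norm u"
      by (rule norm_funpow_le) (use right_half_plane(2)[OF Re_z(2)] Re_z K_ge_1 t in auto)
    also have "(K * t) ^ n \<le> K ^ Suc n * (t ^ Suc n / r)"
    proof -
      have "K ^ n \<le> K ^ Suc n" using K_ge_1 by (intro power_increasing) auto
      moreover have "t ^ n * 1 \<le> t ^ n * (t / r)"
        using t by (intro mult_left_mono) auto
      ultimately have "K ^ n * t ^ n \<le> K ^ Suc n * (t ^ n * (t / r))"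
        using K_ge_1 t by (intro mult_mono) auto
      then show ?thesis by (simp add: power_mult_distrib mult_ac)
    qed
    finally show ?thesis by (simp add: mult_right_mono)
  qed
  have "(?Rz ^^ Suc n) (A (R (R x))) = (?Rz ^^ n) (q *\<^sub>C (?Rz x - R x) - b *\<^sub>C R (R x))"
    unfolding funpow_Suc_right o_apply q_def b_def R_def
    by (simp only: A_resolvent_resolvent_symbol[OF zs \<open>z \<noteq> 1\<close>])
  then have "X ((?Rz ^^ Suc n) (A (R (R x)))) = (?Rz ^^ n) (q *\<^sub>C (?Rz (X x) - X (R x)) - b *\<^sub>C X (R (R x)))"
    using fourier_coeff_resolvent_power[OF t0(2) f_cont zs(1), of 1 x k]
    by (simp add: X_def fourier_coeff_resolvent_power fourier_coeff_diff fourier_coeff_scaleC t0 f_cont zs)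
  also have "\<dots> = q *\<^sub>C (?Rz ^^ Suc n) (X x) - q *\<^sub>C (?Rz ^^ n) (X (R x)) - b *\<^sub>C (?Rz ^^ n) (X (R (R x)))"
    by (simp only: resolvent_power_diff resolvent_power_scaleC zs not_False_eq_True scaleC.diff_right
        funpow_Suc_right o_apply)
  also have "norm \<dots> \<le> cmod q * norm ((?Rz ^^ Suc n) (X x)) + cmod q * norm ((?Rz ^^ n) (X (R x)))
      + cmod b * norm ((?Rz ^^ n) (X (R (R x))))"
    unfolding norm_scaleC[symmetric]
    by (rule order_trans[OF norm_triangle_ineq4 add_right_mono[OF norm_triangle_ineq4]])
  also have "\<dots> \<le> Q * (t ^ Suc n / r) * norm (X x) + 8 * (K ^ Suc n * (t ^ Suc n / r) * norm (X (R x)))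
      + 8 * (K ^ Suc n * (t ^ Suc n / r) * norm (X (R (R x))))"
  proof (intro add_mono)
    show "cmod q * norm ((?Rz ^^ Suc n) (X x)) \<le> Q * (t ^ Suc n / r) * norm (X x)"
      unfolding q_def by (rule symbol)
  qed (rule mult_mono[OF q8 crude] mult_mono[OF b2 crude]; simp)+
  also have "\<dots> \<le> (Q + 8 * K ^ Suc n) * (t ^ Suc n / r) * (norm (X x) + norm (X (R x)) + norm (X (R (R x))))"
  proof -
    have "0 \<le> Q * (t ^ Suc n / r)"
      using \<open>Q \<ge> 0\<close> t by simp
    moreover have "0 \<le> K ^ Suc n * (t ^ Suc n / r)" using K_ge_1 t by simp
    moreover have "a * x + 8 * (b * y) + 8 * (b * w) \<le> (a + 8 * b) * (x + y + w)"
      if "0 \<le> a" "0 \<le> b" "0 \<le> x" "0 \<le> y" "0 \<le> w" for a b x y w :: real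
    proof -
      have "0 \<le> a * y + a * w + 8 * (b * x)" using that by simp
      then show ?thesis by (simp add: algebra_simps)
    qed
    ultimately show ?thesis
      by (simp only: distrib_right[of Q] mult.assoc[of 8] norm_ge_zero)
  qed
  finally have "norm (X ((?Rz ^^ Suc n) (A (R (R x))))) \<le>
    (Q + 8 * K ^ Suc n) * (t ^ Suc n / r) * (norm (X x) + norm (X (R x)) + norm (X (R (R x))))" .
  moreover have "norm (fourier_coeff (orbit_profile (poly p) t (A (R (R x)))) k) =
      (1 / t ^ Suc n) * norm (X ((?Rz ^^ Suc n) (A (R (R x)))))"
    unfolding fourier_coeff_by_parts_iterated[OF t0(1) z p] X_def f using t0 by simp
  ultimately have "norm (fourier_coeff (orbit_profile (poly p) t (A (R (R x)))) k) \<le> (1 / t ^ Suc n) *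
    ((Q + 8 * K ^ Suc n) * (t ^ Suc n / r) * (norm (X x) + norm (X (R x)) + norm (X (R (R x)))))"
    using t0 by (simp only:) (intro mult_left_mono, auto)
  also have "\<dots> = (Q + 8 * K ^ Suc n) / r * (norm (X x) + norm (X (R x)) + norm (X (R (R x))))"
    using t0 by simp
  finally show ?thesis by (simp only: X_def)
qed

text \<open>\<open>C\<close> depends on none of \<open>t\<close>, \<open>r\<close> and
  \<open>x\<close>; this uniformity is what allows a supremum over \<open>r\<close>
  afterwards.\<close>

lemma decay_estimate:
  fixes M :: "real \<Rightarrow> real"
  assumes spec: "\<And>\<eta>. \<eta> \<noteq> 0 \<Longrightarrow> \<i> * complex_of_real \<eta> \<notin> spectrum D A"
    and low: "\<And>s::real. \<bar>s\<bar> \<ge> 1 \<Longrightarrow> onorm (resolvent D A (\<i> * complex_of_real (inverse s))) \<le> M \<bar>s\<bar>"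
    and high: "\<And>s::real. \<bar>s\<bar> \<ge> 1 \<Longrightarrow> onorm (resolvent D A (\<i> * complex_of_real s)) \<le> M \<bar>s\<bar>"
    and mono: "mono_on {1..} M" and pos: "\<And>s. s \<ge> 1 \<Longrightarrow> M s > 0"
    and inc: "\<And>l s. l \<ge> 1 \<Longrightarrow> s \<ge> s0 \<Longrightarrow> M (l * s) / M s \<ge> c * l powr \<alpha>"
    and c: "0 < c" "c \<le> 1" and s0: "s0 \<ge> 1" and "\<alpha> > 0"
  obtains C where "C \<ge> 0"
    "\<And>t r x. t \<ge> 2 \<Longrightarrow> s0 \<le> r \<Longrightarrow> r \<le> t \<Longrightarrow> M r \<le> t \<Longrightarrow>
      norm (T t (A (resolvent D A 1 (resolvent D A 1 x)))) \<le> C / r * norm x"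
proof -
  define R where "R = resolvent D A 1"
  \<comment> \<open>The exponent is written \<open>Suc m0\<close> to be positive, so that the weight
    vanishes at both ends of the interval.\<close>
  obtain m0 where "1 / \<alpha> \<le> real m0" using real_arch_simple by blast
  then have m: "\<alpha> * real (Suc m0) \<ge> 1"
    using \<open>\<alpha> > 0\<close> by (simp add: field_simps)
  define p :: "real poly" where "p = [:0, 1, -1:] ^ Suc m0"
  define f where "f = poly ((pderiv ^^ Suc m0) p)"
  have f_cont: "continuous_on {0..1} f"
    unfolding f_def by (intro continuous_intros)
  have "bounded (f ` {0..1})"
    by (intro compact_imp_bounded compact_continuous_image f_cont) simp_all
  then obtain B where "B > 0" "\<forall>x\<in>f ` {0..1}. norm x \<le> B"
    unfolding bounded_pos by blast
  then have B: "\<bar>f s\<bar> \<le> B" if "s \<in> {0..1}" for s using that by auto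
  define I0 where "I0 = integral {0..1} (\<lambda>s. (poly p s)\<^sup>2)"
  have "I0 > 0"
  proof -
    have cont: "continuous_on {0..1} (\<lambda>s. (poly p s)\<^sup>2)" by (intro continuous_intros)
    have "I0 \<ge> 0" unfolding I0_def by (intro integral_nonneg integrable_continuous_real cont) simp
    moreover have "I0 \<noteq> 0"
    proof
      assume "I0 = 0"
      then have "(poly p (1 / 2))\<^sup>2 = 0"
        unfolding I0_def by (subst (asm) integral_eq_0_iff[OF cont]) auto
      then show False by (simp add: p_def)
    qed
    ultimately show ?thesis by simp
  qed
  define Q where "Q = 8 * (1 + K) ^ Suc m0 * (s0 / c ^ Suc m0)"
  define E where "E = Q + 8 * K ^ Suc m0"
  define W where "W = K * exp 1 * (3 * E * (B * K * K\<^sup>2))"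
  have "Q \<ge> 0" unfolding Q_def using K_ge_1 s0 c by (intro mult_nonneg_nonneg) auto
  then have "E \<ge> 0" unfolding E_def using K_ge_1 by (intro add_nonneg_nonneg) auto
  have "W \<ge> 0" unfolding W_def using K_ge_1 \<open>B > 0\<close> \<open>E \<ge> 0\<close> by (intro mult_nonneg_nonneg) auto
  have main: "norm (T t (A (R (R x)))) \<le> W / sqrt I0 / r * norm x"
    if t: "t \<ge> 2" and r: "s0 \<le> r" "r \<le> t" "M r \<le> t" for t r x
  proof -
    have "t > 0" "t \<ge> 0" "r \<ge> 1" "r > 0" using t r s0 by auto
    define y where "y = A (R (R x))"
    define Y where "Y u k = (norm (fourier_coeff (orbit_profile f t u) k))\<^sup>2" for u k
    \<comment> \<open>One bound for all three applications of Bessel's inequality: as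
      \<open>K \<ge> 1\<close>, each of \<open>x\<close>, \<open>R x\<close> and
      \<open>R (R x)\<close> has norm at most \<open>K\<^sup>2 * norm x\<close>.\<close>
    define V where "V = B * K * (K\<^sup>2 * norm x)"
    have "norm (R (R x)) \<le> K * norm (R x)" and R1: "norm (R x) \<le> K * norm x"
      unfolding R_def by (rule norm_resolvent_1_le)+
    moreover have "K * norm (R x) \<le> K * (K * norm x)"
      using R1 K_ge_1 by (intro mult_left_mono) auto
    moreover have "1 * (K * norm x) \<le> K * (K * norm x)" "1 * norm x \<le> K * norm x"
      using K_ge_1 by (intro mult_right_mono; simp)+
    ultimately have norms: "norm x \<le> K\<^sup>2 * norm x" "norm (R x) \<le> K\<^sup>2 * norm x" "norm (R (R x)) \<le> K\<^sup>2 * norm x"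
      by (simp_all add: power2_eq_square)
    have sumY: "(\<Sum>k\<in>F. Y u k) \<le> V\<^sup>2" if "finite F" "norm u \<le> K\<^sup>2 * norm x" for u F
    proof -
      have "(\<Sum>k\<in>F. Y u k) \<le> integral {0..1} (\<lambda>s. (norm (orbit_profile f t u s))\<^sup>2)"
        unfolding Y_def
        by (intro bessel_inequality continuous_on_orbit_profile \<open>t \<ge> 0\<close> f_cont that)
      also have "\<dots> \<le> (B * K * norm u)\<^sup>2"
        by (intro integral_norm_orbit_profile_le \<open>t \<ge> 0\<close> f_cont B)
      also have "\<dots> \<le> V\<^sup>2"
        unfolding V_def using that \<open>B > 0\<close> K_ge_1 by (intro power_mono mult_left_mono) auto
      finally show ?thesis .
    qed
    have coeff: "(norm (fourier_coeff (orbit_profile (poly p) t y) k))\<^sup>2 \<le>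
        (E / r)\<^sup>2 * (3 * (Y x k + Y (R x) k + Y (R (R x)) k))" for k
    proof -
      define z where "z = Complex (1 / t) (2 * pi * real_of_int k / t)"
      have symbol: "cmod (z / (1 - z)\<^sup>2) * norm ((resolvent D A z ^^ Suc m0) u) \<le> Q * (t ^ Suc m0 / r) * norm u" for u
        unfolding Q_def
        by (rule symbol_resolvent_power_le[OF spec low high mono pos inc c s0 m t r]) (simp_all add: z_def)
      have "norm (fourier_coeff (orbit_profile (poly p) t y) k) \<le> E / r *
          (norm (fourier_coeff (orbit_profile f t x) k) + norm (fourier_coeff (orbit_profile f t (R x)) k) +
           norm (fourier_coeff (orbit_profile f t (R (R x))) k))"
        unfolding y_def R_def E_def
        by (rule norm_fourier_coeff_le[OF t \<open>r \<ge> 1\<close> \<open>r \<le> t\<close> z_def symbol \<open>Q \<ge> 0\<close> _ f_def]) (simp_all add: p_def)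
      then have "(norm (fourier_coeff (orbit_profile (poly p) t y) k))\<^sup>2 \<le> (E / r *
          (norm (fourier_coeff (orbit_profile f t x) k) + norm (fourier_coeff (orbit_profile f t (R x)) k) +
           norm (fourier_coeff (orbit_profile f t (R (R x))) k)))\<^sup>2"
        by (intro power_mono) auto
      also have "\<dots> \<le> (E / r)\<^sup>2 * (3 * (Y x k + Y (R x) k + Y (R (R x)) k))"
        unfolding power_mult_distrib[of "E / r"] Y_def by (intro mult_left_mono square_add3_le) auto
      finally show ?thesis .
    qed
    have sum_coeff: "(\<Sum>k\<in>F. (norm (fourier_coeff (orbit_profile (poly p) t y) k))\<^sup>2) \<le> (3 * (E / r) * V)\<^sup>2"
      if "finite F" for F
    proof -
      have "(\<Sum>k\<in>F. (norm (fourier_coeff (orbit_profile (poly p) t y) k))\<^sup>2) \<le>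
          (\<Sum>k\<in>F. (E / r)\<^sup>2 * (3 * (Y x k + Y (R x) k + Y (R (R x)) k)))"
        by (intro sum_mono coeff)
      also have "\<dots> = (E / r)\<^sup>2 * (3 * ((\<Sum>k\<in>F. Y x k) + (\<Sum>k\<in>F. Y (R x) k) + (\<Sum>k\<in>F. Y (R (R x)) k)))"
        by (simp only: sum_distrib_left[symmetric] sum.distrib)
      also have "\<dots> \<le> (E / r)\<^sup>2 * (3 * (V\<^sup>2 + V\<^sup>2 + V\<^sup>2))"
        by (intro mult_left_mono add_mono sumY[OF that] norms) auto
      \<comment> \<open>One factor 3 comes from squaring a sum of three terms, the other from adding
        three Bessel bounds.\<close>
      also have "\<dots> = (3 * (E / r) * V)\<^sup>2" by (simp add: power_mult_distrib power_divide)
      finally show ?thesis .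
    qed
    have "1 \<notin> spectrum D A" by (rule right_half_plane) simp
    have RD: "R u \<in> D" and AR: "A (R u) = R u - u" for u
      using resolvent_in_D[OF \<open>1 \<notin> _\<close>, of u] resolvent_right[OF \<open>1 \<notin> _\<close>, of u]
      by (auto simp: R_def scaleC_one algebra_simps)
    \<comment> \<open>By \<open>AR\<close>, \<open>y\<close> is \<open>R (R x) - R x\<close>, a
      difference of two vectors in \<open>D\<close>.\<close>
    have "y \<in> D" unfolding y_def AR by (intro A_diff RD)
    obtain L where L: "L \<ge> 0" "\<And>s r. s \<in> {0..1} \<Longrightarrow> r \<in> {0..1} \<Longrightarrow>
      norm (orbit_profile (poly p) t y s - orbit_profile (poly p) t y r) \<le> L * \<bar>s - r\<bar>"
      using orbit_profile_lipschitz[OF \<open>t > 0\<close> \<open>y \<in> D\<close>, of p] by blast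
    have "orbit_profile (poly p) t y 0 = orbit_profile (poly p) t y 1"
      by (simp add: orbit_profile_def p_def)
    from lipschitz_chord[OF L(2) \<open>L \<ge> 0\<close> this]
    have "integral {0..1} (\<lambda>s. (norm (orbit_profile (poly p) t y s))\<^sup>2) \<le> (3 * (E / r) * V)\<^sup>2"
      by (intro parseval_lower_bound[where L=L] continuous_on_orbit_profile \<open>t \<ge> 0\<close> \<open>L \<ge> 0\<close> sum_coeff)
         (auto intro!: continuous_intros)
    then have "I0 * (norm (T t y))\<^sup>2 \<le> (K * exp 1)\<^sup>2 * (3 * (E / r) * V)\<^sup>2"
      unfolding I0_def
      by (intro order_trans[OF norm_T_le_integral[OF \<open>t \<ge> 0\<close>]] mult_left_mono continuous_intros) auto
    also have "\<dots> = (W / r * norm x)\<^sup>2"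
    proof -
      have "K * exp 1 * (3 * (E / r) * V) = W / r * norm x"
        by (simp add: W_def V_def)
      then show ?thesis by (simp only: power_mult_distrib[symmetric])
    qed
    finally have "(sqrt I0 * norm (T t y))\<^sup>2 \<le> (W / r * norm x)\<^sup>2"
      using \<open>I0 > 0\<close> by (simp add: power_mult_distrib)
    then have "sqrt I0 * norm (T t y) \<le> W / r * norm x"
      by (rule power2_le_imp_le) (use \<open>W \<ge> 0\<close> \<open>r > 0\<close> in simp)
    then have "norm (T t y) \<le> W / r * norm x / sqrt I0"
      using divide_right_mono[of _ _ "sqrt I0"] \<open>I0 > 0\<close> by fastforce
    then show ?thesis by (simp add: y_def mult_ac)
  qed
  show ?thesis
    by (rule that[of "W / sqrt I0"]) (use \<open>W \<ge> 0\<close> \<open>I0 > 0\<close> main in \<open>auto simp: R_def\<close>)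
qed

end

theorem theorem3p9:
  fixes T :: "real \<Rightarrow> 'a::complex_hilbert_space \<Rightarrow> 'a"
    and D :: "'a set" and A :: "'a \<Rightarrow> 'a"
    and M0 Minf M :: "real \<Rightarrow> real"
  assumes "C0_semigroup T" and "bounded_semigroup T"
    and "is_generator T D A"
    and "spectrum D A \<inter> range (\<lambda>s::real. \<i> * complex_of_real s) = {0}"
    and "continuous_on {1..} M0" and "mono_on {1..} M0" and "\<And>s. s \<ge> 1 \<Longrightarrow> M0 s > 0"
    and "continuous_on {1..} Minf" and "mono_on {1..} Minf" and "\<And>s. s \<ge> 1 \<Longrightarrow> Minf s > 0"
    and "\<And>s::real. \<bar>s\<bar> \<ge> 1 \<Longrightarrow>
      onorm (resolvent D A (\<i> * complex_of_real (inverse s))) \<le> M0 \<bar>s\<bar>"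
    and "\<And>s::real. \<bar>s\<bar> \<ge> 1 \<Longrightarrow>
      onorm (resolvent D A (\<i> * complex_of_real s)) \<le> Minf \<bar>s\<bar>"
    and "\<And>s. s \<ge> 1 \<Longrightarrow> M s = max (M0 s) (Minf s)"
    and "positive_increase 1 M"
  shows "(\<lambda>t. onorm (T t \<circ> A \<circ> resolvent D A 1 \<circ> resolvent D A 1))
    \<in> O(\<lambda>t. 1 / right_inverse 1 M t)"
proof -
  obtain K0 where K0: "\<And>t. t \<ge> 0 \<Longrightarrow> onorm (T t) \<le> K0"
    using assms(2) unfolding bounded_semigroup_def bdd_above_def by auto
  \<comment> \<open>The maximum with 1 makes powers of the bound increase with the exponent, which
    the estimates use throughout.\<close>
  interpret bounded_C0_semigroup T D A "max 1 K0"
  proof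
    fix t :: real and x assume "t \<ge> 0"
    then have "bounded_linear (T t)"
      using assms(1) by (simp add: C0_semigroup_def bounded_clinear_def)
    then have "norm (T t x) \<le> onorm (T t) * norm x" by (rule onorm)
    also have "\<dots> \<le> max 1 K0 * norm x"
      using K0[OF \<open>t \<ge> 0\<close>] by (intro mult_right_mono) auto
    finally show "norm (T t x) \<le> max 1 K0 * norm x" .
  qed (use assms(1,3) in auto)
  have spec: "\<i> * complex_of_real \<eta> \<notin> spectrum D A" if "\<eta> \<noteq> 0" for \<eta>
  proof
    assume "\<i> * complex_of_real \<eta> \<in> spectrum D A"
    then have "\<i> * complex_of_real \<eta> \<in> {0}" unfolding assms(4)[symmetric] by blast
    then show False using that by simp
  qed
  have low: "onorm (resolvent D A (\<i> * complex_of_real (inverse s))) \<le> M \<bar>s\<bar>" if "\<bar>s\<bar> \<ge> 1" for s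
    using assms(11)[OF that] assms(13)[OF that] by simp
  have high: "onorm (resolvent D A (\<i> * complex_of_real s)) \<le> M \<bar>s\<bar>" if "\<bar>s\<bar> \<ge> 1" for s
    using assms(12)[OF that] assms(13)[OF that] by simp
  have pos: "M s > 0" if "s \<ge> 1" for s
    using assms(7)[OF that] assms(13)[OF that] by simp
  have mono: "mono_on {1..} M"
  proof (rule mono_onI)
    fix r s :: real assume "r \<in> {1..}" "s \<in> {1..}" "r \<le> s"
    moreover from this have "M0 r \<le> M0 s" "Minf r \<le> Minf s"
      by (blast intro: mono_onD[OF assms(6)] mono_onD[OF assms(9)])+
    ultimately show "M r \<le> M s"
      using max.mono[of "M0 r" "M0 s" "Minf r" "Minf s"] by (simp add: assms(13))
  qed
  \<comment> \<open>The point i/s has distance 1/s from the spectral value 0. The bound gives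
    \<open>r \<le> t\<close> whenever \<open>M r \<le> t\<close>, and it bounds the set in
    \<open>right_inverse\<close>.\<close>
  have ge: "s \<le> M s" if "s \<ge> 1" for s
  proof -
    have "0 \<in> spectrum D A" using assms(4) by auto
    from onorm_resolvent_ge_inverse[OF this spec[of "inverse s"]] low[of s] that
    have "1 \<le> inverse s * onorm (resolvent D A (\<i> * complex_of_real (inverse s)))"
      by (simp add: norm_mult norm_inverse)
    also have "\<dots> \<le> inverse s * M s" using low[of s] that by (intro mult_left_mono) auto
    finally show ?thesis using that by (simp add: field_simps)
  qed
  obtain \<alpha> c s0 where "\<alpha> > 0" and c: "0 < c" "c \<le> 1" and s0: "s0 \<ge> 1"
    and inc: "\<And>l s. l \<ge> 1 \<Longrightarrow> s \<ge> s0 \<Longrightarrow> M (l * s) / M s \<ge> c * l powr \<alpha>"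
    using assms(14) unfolding positive_increase_def by auto
  obtain C where "C \<ge> 0" and C: "\<And>t r x. t \<ge> 2 \<Longrightarrow> s0 \<le> r \<Longrightarrow> r \<le> t \<Longrightarrow> M r \<le> t \<Longrightarrow>
      norm (T t (A (resolvent D A 1 (resolvent D A 1 x)))) \<le> C / r * norm x"
    using decay_estimate[OF spec low high mono pos inc c s0 \<open>\<alpha> > 0\<close>] by blast
  define N where "N t = onorm (T t \<circ> A \<circ> resolvent D A 1 \<circ> resolvent D A 1)" for t
  have N_le: "N t \<le> C / r" if "t \<ge> 2" "s0 \<le> r" "M r \<le> t" for t r
    unfolding N_def using C[OF that(1,2) _ that(3)] ge[of r] that s0 \<open>C \<ge> 0\<close>
    by (intro onorm_bound) auto
  \<comment> \<open>Nonnegativity of \<open>onorm\<close> is available for bounded linear maps, and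
    \<open>A\<close> alone need not be one. The identity A R(1,A) = R(1,A) - I rewrites the
    composition as such a map.\<close>
  have N_nonneg: "0 \<le> N t" if "t \<ge> 0" for t
  proof -
    have one: "1 \<notin> spectrum D A" by (rule right_half_plane) simp
    have "T t \<circ> A \<circ> resolvent D A 1 \<circ> resolvent D A 1 =
        (\<lambda>x. T t (resolvent D A 1 (resolvent D A 1 x) - resolvent D A 1 x))"
    proof
      fix x
      have "A (resolvent D A 1 u) = resolvent D A 1 u - u" for u
        using resolvent_right[OF one, of u] by (simp add: scaleC_one algebra_simps)
      then show "(T t \<circ> A \<circ> resolvent D A 1 \<circ> resolvent D A 1) x =
          T t (resolvent D A 1 (resolvent D A 1 x) - resolvent D A 1 x)" by simp
    qed
    then show ?thesis
      unfolding N_def using that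
      by (simp only:) (intro onorm_pos_le bounded_linear_compose[OF bounded_linear_T] bounded_linear_sub
          bounded_linear_compose[OF bounded_linear_resolvent bounded_linear_resolvent]
          bounded_linear_resolvent one)
  qed
  have "norm (N t) \<le> C * norm (1 / right_inverse 1 M t)" if "t \<ge> max 2 (M s0)" for t
  proof -
    define S where "S = {r. 1 \<le> r \<and> M r \<le> t}"
    have "s0 \<in> S" using that s0 by (simp add: S_def)
    have "bdd_above S" using ge by (intro bdd_aboveI[of _ t]) (force simp: S_def)
    then have "s0 \<le> Sup S" using \<open>s0 \<in> S\<close> by (rule cSup_upper[rotated])
    \<comment> \<open>Every element of \<open>S\<close> from \<open>s0\<close> on satisfies
      \<open>N_le\<close>, and the supremum inherits the bound. The product form covers
      \<open>N t = 0\<close>.\<close>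
    have "N t * Sup S \<le> C"
    proof (cases "N t = 0")
      case False
      then have "N t > 0" using N_nonneg[of t] that by simp
      have large: "r \<le> C / N t" if "r \<in> S" "s0 \<le> r" for r
        using N_le[of t r] that \<open>t \<ge> max 2 (M s0)\<close> \<open>N t > 0\<close> s0 by (simp add: S_def field_simps)
      \<comment> \<open>Elements below \<open>s0\<close> are bounded through \<open>s0\<close>,
        which itself lies in \<open>S\<close>.\<close>
      have "r \<le> C / N t" if "r \<in> S" for r
        using large[OF that] large[OF \<open>s0 \<in> S\<close>] by (cases "s0 \<le> r") auto
      then have "Sup S \<le> C / N t" using \<open>s0 \<in> S\<close> by (intro cSup_least) auto
      then show ?thesis using \<open>N t > 0\<close> by (simp add: field_simps)
    qed (use \<open>C \<ge> 0\<close> in simp)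
    then show ?thesis
      using \<open>s0 \<le> Sup S\<close> s0 N_nonneg[of t] that
      by (simp add: right_inverse_def S_def[symmetric] field_simps)
  qed
  then show ?thesis
    unfolding N_def[symmetric] by (intro bigoI[of _ C] eventually_at_top_linorderI) blast
qed

end
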